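(* Let $N\ge 1$ be an integer, $\beta$ a positive integer and $\omega>0$ a real number. Consider the operators $\mathcal H_n,\mathcal I_{n-1}$ (trigonometric) and $\mathcal H_n^\omega,\mathcal I_{n-1}^\omega$ (rational), acting on superpolynomials in $(x,\theta)$, together with $\Delta=\sum_{j=1}^N D_j^2$, as defined in the context. Then for every $n=1,\ldots,N$, $$\mathcal H_n^\omega=e^{-\frac{1}{4\omega}\Delta}\,\mathcal H_n\,e^{\frac{1}{4\omega}\Delta}\qquad\text{and}\qquad \mathcal I_{n-1}^\omega=e^{-\frac{1}{4\omega}\Delta}\,\mathcal I_{n-1}\,e^{\frac{1}{4\omega}\Delta}.$$
   Context: A superpolynomial is an element of the algebra generated by commuting variables $x_1,\ldots,x_N$ and anticommuting variables $\theta_1,\ldots,\theta_N$ (the $x$'s commute with the $\theta$'s; $\theta_i\theta_j=-\theta_j\theta_i$, $\theta_i^2=0$), with complex coefficients. Notation: $x_{ij}=x_i-x_j$, $\partial_i=\partial/\partial x_i$, and $\partial_{\theta_i}$ is the (left) derivative with respect to $\theta_i$. $K_{ij}$ is the operator exchanging the variables $x_i$ and $x_j$; $\kappa_{ij}$ exchanges $\theta_i$ and $\theta_j$; $\mathcal K_{ij}=\kappa_{ij}K_{ij}$. For $w\in S_N$, with a decomposition $w=\sigma_{i_1}\cdots\sigma_{i_r}$ into simple transpositions, $\mathcal K_w=\mathcal K_{i_1,i_1+1}\cdots\mathcal K_{i_r,i_r+1}$ (so $S_N$ permutes the $x$'s and $\theta$'s simultaneously). Trigonometric Dunkl (Cherednik)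 operators: $$\mathcal D_j=x_j\partial_j+\beta\sum_{k<j}\frac{x_j}{x_{jk}}(1-K_{jk})+\beta\sum_{k>j}\frac{x_k}{x_{jk}}(1-K_{jk})-\beta(j-1),\quad j=1,\ldots,N.$$ Rational Dunkl operators: $$D_j=\partial_j+\beta\sum_{k\ne j}\frac{1}{x_{jk}}(1-K_{jk}),\qquad D_j^\dagger=2\omega x_j-D_j,\qquad \Delta=\sum_{j=1}^N D_j^2 .$$ Deformed operators: $$\mathcal D_j^\omega=\frac{1}{2\omega}D_j^\dagger D_j+\beta\sum_{k>j}K_{jk}-\beta(N-1).$$ For $n=1,\ldots,N$ set $$\mathcal H_n=\sum_{i=1}^N\mathcal D_i^n,\qquad \mathcal I_{n-1}=\sum_{w\in S_N}\mathcal K_w\,\theta_1\partial_{\theta_1}\mathcal D_1^{\,n-1},$$ $$\mathcal H_n^\omega=\sum_{j=1}^N(\mathcal D_j^\omega)^n,\qquad \mathcal I_{n-1}^\omega=\sum_{w\in S_N}\mathcal K_w\,\theta_1\partial_{\theta_1}(\mathcal D_1^\omega)^{n-1}.$$ All these operators map superpolynomials to superpolynomials. Since $\Delta$ lowers the degree in $x$ by $2$, $e^{\pm\frac{1}{4\omega}\Delta}=\sum_{k\ge0}\frac{1}{k!}\left(\pm\frac{1}{4\omega}\Delta\right)^k$ is a finite sum when applied to any given superpolynomial. *)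

theory Defs
  imports Complex_Main "HOL-Library.Poly_Mapping" "HOL-Combinatorics.Permutations"
begin

section \<open>Polynomials and superpolynomials\<close>

type_synonym mpoly = "(nat \<Rightarrow>\<^sub>0 nat) \<Rightarrow>\<^sub>0 complex"

text \<open>
  Anticommutativity lets every superpolynomial be written uniquely as the sum over \<open>I\<close> of
  \<open>\<theta>\<^sub>I f\<^sub>I\<close>, where \<open>\<theta>\<^sub>I\<close> is the product of the \<open>\<theta>\<^sub>i\<close>, \<open>i \<in> I\<close>, taken in increasing order of \<open>i\<close>,
  and \<open>f\<^sub>I\<close> is a polynomial in the \<open>x\<^sub>i\<close>.  It is represented by the map from \<open>I\<close> to \<open>f\<^sub>I\<close>.
\<close>

type_synonym superpoly = "nat set \<Rightarrow>\<^sub>0 mpoly"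

definition superpolys :: "nat \<Rightarrow> superpoly set" where
  "superpolys N = {F. \<forall>I \<in> Poly_Mapping.keys F. I \<subseteq> {1..N} \<and>
     (\<forall>m \<in> Poly_Mapping.keys (Poly_Mapping.lookup F I). Poly_Mapping.keys m \<subseteq> {1..N})}"

definition Const :: "complex \<Rightarrow> mpoly" where
  "Const c = Poly_Mapping.single 0 c"

definition X :: "nat \<Rightarrow> mpoly" where
  "X i = Poly_Mapping.single (Poly_Mapping.single i 1) 1"

definition pderiv_x :: "nat \<Rightarrow> mpoly \<Rightarrow> mpoly" where
  "pderiv_x i p = (\<Sum>m \<in> Poly_Mapping.keys p.
     Poly_Mapping.single (m - Poly_Mapping.single i 1)
       (of_nat (Poly_Mapping.lookup m i) * Poly_Mapping.lookup p m))"

definition K :: "nat \<Rightarrow> nat \<Rightarrow> mpoly \<Rightarrow> mpoly" where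
  "K i j = Poly_Mapping.map_key (Poly_Mapping.map_key (transpose i j))"

text \<open>
  \<open>divdiff j k\<close> is the operator \<open>(1 - K\<^sub>j\<^sub>k) / (x\<^sub>j - x\<^sub>k)\<close>, for \<open>j \<noteq> k\<close>.  The quotient exists and is
  unique; see \<open>divdiff_unique\<close> and \<open>divdiff_eq\<close> below.
\<close>

definition divdiff :: "nat \<Rightarrow> nat \<Rightarrow> mpoly \<Rightarrow> mpoly" where
  "divdiff j k p = (THE q. (X j - X k) * q = p - K j k p)"

section \<open>Dunkl operators on polynomials\<close>

definition cherednik :: "nat \<Rightarrow> nat \<Rightarrow> nat \<Rightarrow> mpoly \<Rightarrow> mpoly" where
  "cherednik N \<beta> j p = X j * pderiv_x j p
     + of_nat \<beta> * (\<Sum>k \<in> {1..<j}. X j * divdiff j k p)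
     + of_nat \<beta> * (\<Sum>k \<in> {j<..N}. X k * divdiff j k p)
     - of_nat \<beta> * (of_nat j - 1) * p"

definition dunkl :: "nat \<Rightarrow> nat \<Rightarrow> nat \<Rightarrow> mpoly \<Rightarrow> mpoly" where
  "dunkl N \<beta> j p = pderiv_x j p + of_nat \<beta> * (\<Sum>k \<in> {1..N} - {j}. divdiff j k p)"

definition dunkl_dagger :: "nat \<Rightarrow> nat \<Rightarrow> real \<Rightarrow> nat \<Rightarrow> mpoly \<Rightarrow> mpoly" where
  "dunkl_dagger N \<beta> \<omega> j p = Const (2 * of_real \<omega>) * X j * p - dunkl N \<beta> j p"

definition cherednik_omega :: "nat \<Rightarrow> nat \<Rightarrow> real \<Rightarrow> nat \<Rightarrow> mpoly \<Rightarrow> mpoly" where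
  "cherednik_omega N \<beta> \<omega> j p = Const (1 / (2 * of_real \<omega>)) * dunkl_dagger N \<beta> \<omega> j (dunkl N \<beta> j p)
     + of_nat \<beta> * (\<Sum>k \<in> {j<..N}. K j k p)
     - of_nat \<beta> * (of_nat N - 1) * p"

definition laplacian :: "nat \<Rightarrow> nat \<Rightarrow> mpoly \<Rightarrow> mpoly" where
  "laplacian N \<beta> p = (\<Sum>j \<in> {1..N}. (dunkl N \<beta> j ^^ 2) p)"

section \<open>Operators on superpolynomials\<close>

text \<open>
  Since the \<open>x\<close>'s commute with the \<open>\<theta>\<close>'s, an operator on polynomials acts on superpolynomials
  coefficient by coefficient.
\<close>

definition coeffwise :: "(mpoly \<Rightarrow> mpoly) \<Rightarrow> superpoly \<Rightarrow> superpoly" where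
  "coeffwise T = Poly_Mapping.map T"

definition scale :: "complex \<Rightarrow> superpoly \<Rightarrow> superpoly" where
  "scale c = coeffwise (\<lambda>p. Const c * p)"

definition theta_sign :: "nat \<Rightarrow> nat set \<Rightarrow> mpoly" where
  "theta_sign i I = (-1) ^ card {k \<in> I. k < i}"

text \<open>Moving \<open>\<theta>\<^sub>i\<close> into its place in \<open>\<theta>\<^sub>I\<close> costs one sign for each \<open>k \<in> I\<close> with \<open>k < i\<close>.\<close>

lift_definition theta :: "nat \<Rightarrow> (nat set \<Rightarrow>\<^sub>0 mpoly) \<Rightarrow> nat set \<Rightarrow>\<^sub>0 mpoly" is
  "\<lambda>i F J. if i \<in> J then theta_sign i J * F (J - {i}) else 0"
proof -
  fix i and F :: "nat set \<Rightarrow> mpoly"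
  assume fin: "finite {I. F I \<noteq> 0}"
  have "{J. (if i \<in> J then theta_sign i J * F (J - {i}) else 0) \<noteq> 0} \<subseteq> insert i ` {I. F I \<noteq> 0}"
  proof
    fix J assume "J \<in> {J. (if i \<in> J then theta_sign i J * F (J - {i}) else 0) \<noteq> 0}"
    then have "i \<in> J" "F (J - {i}) \<noteq> 0" by (auto split: if_splits)
    then show "J \<in> insert i ` {I. F I \<noteq> 0}"
      by (intro image_eqI[of _ _ "J - {i}"]) auto
  qed
  then show "finite {J. (if i \<in> J then theta_sign i J * F (J - {i}) else 0) \<noteq> 0}"
    using fin finite_subset by blast
qed

lift_definition dtheta :: "nat \<Rightarrow> (nat set \<Rightarrow>\<^sub>0 mpoly) \<Rightarrow> nat set \<Rightarrow>\<^sub>0 mpoly" is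
  "\<lambda>i F J. if i \<in> J then 0 else theta_sign i J * F (insert i J)"
proof -
  fix i and F :: "nat set \<Rightarrow> mpoly"
  assume fin: "finite {I. F I \<noteq> 0}"
  have "{J. (if i \<in> J then 0 else theta_sign i J * F (insert i J)) \<noteq> 0} \<subseteq> (\<lambda>I. I - {i}) ` {I. F I \<noteq> 0}"
  proof
    fix J assume "J \<in> {J. (if i \<in> J then 0 else theta_sign i J * F (insert i J)) \<noteq> 0}"
    then have "i \<notin> J" "F (insert i J) \<noteq> 0" by (auto split: if_splits)
    then show "J \<in> (\<lambda>I. I - {i}) ` {I. F I \<noteq> 0}"
      by (intro image_eqI[of _ _ "insert i J"]) auto
  qed
  then show "finite {J. (if i \<in> J then 0 else theta_sign i J * F (insert i J)) \<noteq> 0}"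
    using fin finite_subset by blast
qed

text \<open>
  Replacing each factor \<open>\<theta>\<^sub>i\<close> of \<open>\<theta>\<^sub>I\<close> by \<open>\<theta>\<close> with index \<open>w i\<close> and reordering the factors gives
  \<open>reorder_sign w I\<close> times the ordered product indexed by the image of \<open>I\<close> under \<open>w\<close>.
\<close>

definition reorder_sign :: "(nat \<Rightarrow> nat) \<Rightarrow> nat set \<Rightarrow> mpoly" where
  "reorder_sign w I = (-1) ^ card {(k, l). k \<in> I \<and> l \<in> I \<and> k < l \<and> w l < w k}"

lift_definition kappa :: "nat \<Rightarrow> nat \<Rightarrow> (nat set \<Rightarrow>\<^sub>0 mpoly) \<Rightarrow> nat set \<Rightarrow>\<^sub>0 mpoly" is
  "\<lambda>i j F J. reorder_sign (transpose i j) (transpose i j ` J) * F (transpose i j ` J)"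
proof -
  fix i j and F :: "nat set \<Rightarrow> mpoly"
  assume fin: "finite {I. F I \<noteq> 0}"
  have "{J. reorder_sign (transpose i j) (transpose i j ` J) * F (transpose i j ` J) \<noteq> 0}
      \<subseteq> (\<lambda>I. transpose i j ` I) ` {I. F I \<noteq> 0}"
  proof
    fix J assume "J \<in> {J. reorder_sign (transpose i j) (transpose i j ` J) * F (transpose i j ` J) \<noteq> 0}"
    then show "J \<in> (\<lambda>I. transpose i j ` I) ` {I. F I \<noteq> 0}"
      by (intro image_eqI[of _ _ "transpose i j ` J"]) (auto simp: image_comp)
  qed
  then show "finite {J. reorder_sign (transpose i j) (transpose i j ` J) * F (transpose i j ` J) \<noteq> 0}"
    using fin finite_subset by blast
qed

definition calK :: "nat \<Rightarrow> nat \<Rightarrow> superpoly \<Rightarrow> superpoly" where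
  "calK i j F = kappa i j (coeffwise (K i j) F)"

text \<open>A word \<open>[i\<^sub>1, \<dots>, i\<^sub>r]\<close> stands for the product of the simple transpositions \<open>(i\<^sub>s, i\<^sub>s + 1)\<close>.\<close>

definition word_perm :: "nat list \<Rightarrow> nat \<Rightarrow> nat" where
  "word_perm is = foldr (\<lambda>i w. transpose i (Suc i) \<circ> w) is id"

definition calK_word :: "nat list \<Rightarrow> superpoly \<Rightarrow> superpoly" where
  "calK_word is = foldr (\<lambda>i T. calK i (Suc i) \<circ> T) is id"

text \<open>
  Every permutation of \<open>{1..N}\<close> has a decomposition, and the operator does not depend on
  which one is chosen; see \<open>word_perm_exists\<close> and \<open>calK_perm_eq\<close> below.
\<close>

definition calK_perm :: "nat \<Rightarrow> (nat \<Rightarrow> nat) \<Rightarrow> superpoly \<Rightarrow> superpoly" where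
  "calK_perm N w = calK_word (SOME is. set is \<subseteq> {1..<N} \<and> word_perm is = w)"

definition H_trig :: "nat \<Rightarrow> nat \<Rightarrow> nat \<Rightarrow> superpoly \<Rightarrow> superpoly" where
  "H_trig N \<beta> n F = (\<Sum>i \<in> {1..N}. (coeffwise (cherednik N \<beta> i) ^^ n) F)"

text \<open>\<open>I_trig N \<beta> m\<close> and \<open>I_rat N \<beta> \<omega> m\<close> carry the index \<open>m = n - 1\<close>, the exponent of the operator.\<close>

definition I_trig :: "nat \<Rightarrow> nat \<Rightarrow> nat \<Rightarrow> superpoly \<Rightarrow> superpoly" where
  "I_trig N \<beta> m F = (\<Sum>w | w permutes {1..N}.
     calK_perm N w (theta 1 (dtheta 1 ((coeffwise (cherednik N \<beta> 1) ^^ m) F))))"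

definition H_rat :: "nat \<Rightarrow> nat \<Rightarrow> real \<Rightarrow> nat \<Rightarrow> superpoly \<Rightarrow> superpoly" where
  "H_rat N \<beta> \<omega> n F = (\<Sum>i \<in> {1..N}. (coeffwise (cherednik_omega N \<beta> \<omega> i) ^^ n) F)"

definition I_rat :: "nat \<Rightarrow> nat \<Rightarrow> real \<Rightarrow> nat \<Rightarrow> superpoly \<Rightarrow> superpoly" where
  "I_rat N \<beta> \<omega> m F = (\<Sum>w | w permutes {1..N}.
     calK_perm N w (theta 1 (dtheta 1 ((coeffwise (cherednik_omega N \<beta> \<omega> 1) ^^ m) F))))"

definition Delta :: "nat \<Rightarrow> nat \<Rightarrow> superpoly \<Rightarrow> superpoly" where
  "Delta N \<beta> = coeffwise (laplacian N \<beta>)"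

text \<open>
  The sum ranges over all \<open>k\<close>; \<open>Sum_any\<close> adds up the nonzero terms.  For multiples of \<open>Delta\<close>
  there are finitely many of them; see \<open>finite_exp_Delta\<close> below.
\<close>

definition exp_op :: "(superpoly \<Rightarrow> superpoly) \<Rightarrow> superpoly \<Rightarrow> superpoly" where
  "exp_op T F = Sum_any (\<lambda>k. scale (1 / fact k) ((T ^^ k) F))"

section \<open>Divided differences and finiteness of the exponential series\<close>

lemma inj_map_key_transpose: "inj (Poly_Mapping.map_key (transpose i j) :: (nat \<Rightarrow>\<^sub>0 nat) \<Rightarrow> _)"
proof (rule injI)
  fix a b :: "nat \<Rightarrow>\<^sub>0 nat"
  assume "Poly_Mapping.map_key (transpose i j) a = Poly_Mapping.map_key (transpose i j) b"
  then have "Poly_Mapping.lookup a (transpose i j k) = Poly_Mapping.lookup b (transpose i j k)" for k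
    by (metis map_key.rep_eq comp_apply inj_transpose)
  then show "a = b" by (metis poly_mapping_eqI transpose_involutory)
qed

lemma lookup_map_key_transpose [simp]:
  "Poly_Mapping.lookup (Poly_Mapping.map_key (transpose i j) m) k = Poly_Mapping.lookup m (transpose i j k)"
  by (simp add: map_key.rep_eq inj_transpose)

lemma lookup_K [simp]:
  "Poly_Mapping.lookup (K i j p) m = Poly_Mapping.lookup p (Poly_Mapping.map_key (transpose i j) m)"
  by (simp add: K_def map_key.rep_eq inj_map_key_transpose)

lemma lookup_coeffwise:
  "T 0 = 0 \<Longrightarrow> Poly_Mapping.lookup (coeffwise T F) I = T (Poly_Mapping.lookup F I)"
  by (auto simp: coeffwise_def map.rep_eq when_def)

lemma map_key_transpose_twice [simp]:
  "Poly_Mapping.map_key (transpose i j) (Poly_Mapping.map_key (transpose i j) m) = (m :: nat \<Rightarrow>\<^sub>0 nat)"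
  by (rule poly_mapping_eqI) simp

lemma K_0 [simp]: "K i j 0 = 0"
  by (rule poly_mapping_eqI) simp

lemma K_add: "K i j (p + q) = K i j p + K i j q"
  by (rule poly_mapping_eqI) (simp add: lookup_add)

lemma K_single: "K i j (Poly_Mapping.single m c) = Poly_Mapping.single (Poly_Mapping.map_key (transpose i j) m) c"
  by (rule poly_mapping_eqI) (auto simp: lookup_single when_def)

lemma map_key_transpose_add:
  "Poly_Mapping.map_key (transpose i j) (m + n) = Poly_Mapping.map_key (transpose i j) m + Poly_Mapping.map_key (transpose i j) (n :: nat \<Rightarrow>\<^sub>0 nat)"
  by (rule poly_mapping_eqI) (simp add: lookup_add)

lemma map_key_transpose_single:
  "Poly_Mapping.map_key (transpose i j) (Poly_Mapping.single k (c::nat)) = Poly_Mapping.single (transpose i j k) c"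
  by (rule poly_mapping_eqI) (auto simp: lookup_single when_def transpose_eq_iff)

lemma K_X: "K i j (X k) = X (transpose i j k)"
  by (simp add: X_def K_single map_key_transpose_single)

definition tdeg :: "(nat \<Rightarrow>\<^sub>0 nat) \<Rightarrow> nat" where
  "tdeg m = (\<Sum>i \<in> Poly_Mapping.keys m. Poly_Mapping.lookup m i)"

lemma tdeg_superset: "finite A \<Longrightarrow> Poly_Mapping.keys m \<subseteq> A \<Longrightarrow> tdeg m = (\<Sum>i \<in> A. Poly_Mapping.lookup m i)"
  unfolding tdeg_def by (rule sum.mono_neutral_left) (auto simp: in_keys_iff)

lemma tdeg_add: "tdeg (m + n) = tdeg m + tdeg n"
proof -
  let ?A = "Poly_Mapping.keys m \<union> Poly_Mapping.keys n"
  have "tdeg (m + n) = (\<Sum>i \<in> ?A. Poly_Mapping.lookup (m + n) i)"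
    by (rule tdeg_superset) (use Poly_Mapping.keys_add[of m n] in auto)
  also have "\<dots> = tdeg m + tdeg n"
    by (simp add: lookup_add sum.distrib tdeg_superset[of ?A m] tdeg_superset[of ?A n])
  finally show ?thesis .
qed

lemma tdeg_single [simp]: "tdeg (Poly_Mapping.single i c) = c"
  by (cases "c = 0") (simp_all add: tdeg_def)

definition low :: "nat \<Rightarrow> mpoly set" where
  "low d = {p. \<forall>m \<in> Poly_Mapping.keys p. tdeg m < d}"

lemma low_0 [simp]: "p \<in> low 0 \<longleftrightarrow> p = 0"
  by (auto simp: low_def)

lemma low_zero [simp]: "0 \<in> low d"
  by (simp add: low_def)

lemma low_add: "p \<in> low d \<Longrightarrow> q \<in> low d \<Longrightarrow> p + q \<in> low d"
  using Poly_Mapping.keys_add[of p q] by (fastforce simp: low_def)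

lemma low_sum: "(\<And>i. i \<in> A \<Longrightarrow> f i \<in> low d) \<Longrightarrow> (\<Sum>i \<in> A. f i) \<in> low d"
  by (induction A rule: infinite_finite_induct) (auto intro: low_add)

lemma low_mult: "p \<in> low (Suc d) \<Longrightarrow> q \<in> low e \<Longrightarrow> p * q \<in> low (d + e)"
  using keys_mult[of p q] by (fastforce simp: low_def tdeg_add)

lemma low_Const: "Const c \<in> low (Suc 0)"
  by (auto simp: low_def Const_def tdeg_def)

lemma of_nat_Const: "of_nat n = Const (of_nat n)"
  by (rule poly_mapping_eqI) (auto simp: lookup_of_nat Const_def lookup_single when_def)

lemma low_Const_mult: "p \<in> low d \<Longrightarrow> Const c * p \<in> low d"
  using low_mult[OF low_Const, of p d c] by simp

lemma low_of_nat_mult: "p \<in> low d \<Longrightarrow> of_nat c * p \<in> low d"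
  by (simp add: of_nat_Const low_Const_mult)

lemma low_mono: "p \<in> low d \<Longrightarrow> d \<le> e \<Longrightarrow> p \<in> low e"
  by (auto simp: low_def)

lemma low_exists: "\<exists>d. p \<in> low d"
proof -
  have "tdeg m < Suc (Max (tdeg ` Poly_Mapping.keys p))" if "m \<in> Poly_Mapping.keys p" for m
    using that by (auto simp: less_Suc_eq_le)
  then show ?thesis unfolding low_def by blast
qed

lemma tdeg_map_key_transpose [simp]: "tdeg (Poly_Mapping.map_key (transpose i j) m) = tdeg m"
proof -
  have "tdeg (Poly_Mapping.map_key (transpose i j) m) = (\<Sum>k \<in> transpose i j -` Poly_Mapping.keys m. Poly_Mapping.lookup m (transpose i j k))"
    by (simp add: tdeg_def keys_map_key inj_transpose)
  also have "\<dots> = tdeg m" unfolding tdeg_def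
    by (rule sum.reindex_bij_witness[of _ "transpose i j" "transpose i j"]) auto
  finally show ?thesis .
qed

lemma pderiv_x_low: "p \<in> low (Suc d) \<Longrightarrow> pderiv_x i p \<in> low d"
  unfolding pderiv_x_def
proof (rule low_sum)
  fix m assume p: "p \<in> low (Suc d)" and m: "m \<in> Poly_Mapping.keys p"
  show "Poly_Mapping.single (m - Poly_Mapping.single i 1) (of_nat (Poly_Mapping.lookup m i) * Poly_Mapping.lookup p m) \<in> low d"
  proof (cases "Poly_Mapping.lookup m i = 0")
    case False
    have "m = (m - Poly_Mapping.single i 1) + Poly_Mapping.single i 1"
      using False by (intro poly_mapping_eqI) (auto simp: lookup_add lookup_minus lookup_single when_def)
    then have "tdeg m = tdeg (m - Poly_Mapping.single i 1) + 1"
      by (metis tdeg_add tdeg_single)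
    then show ?thesis using p m by (auto simp: low_def)
  qed simp
qed

text \<open>Every \<open>p - K\<^sub>j\<^sub>k p\<close> is divisible by \<open>x\<^sub>j - x\<^sub>k\<close>, with a quotient of lower degree.\<close>

lemma divdiff_monom:
  "\<exists>q \<in> low (tdeg m). (X j - X k) * q = Poly_Mapping.single m 1 - K j k (Poly_Mapping.single m 1)"
proof (induction "tdeg m" arbitrary: m)
  case 0
  then have "m = 0" by (auto simp: tdeg_def in_keys_iff intro: poly_mapping_eqI)
  then have "K j k (Poly_Mapping.single m 1) = Poly_Mapping.single m 1"
    unfolding K_single by (simp add: inj_transpose)
  then show ?case by (intro bexI[of _ 0]) auto
next
  case (Suc d)
  then obtain i where i: "Poly_Mapping.lookup m i \<noteq> 0"
    by (metis Zero_not_Suc sum.neutral tdeg_def)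
  define n where "n = m - Poly_Mapping.single i 1"
  have m: "m = Poly_Mapping.single i 1 + n"
    using i unfolding n_def by (intro poly_mapping_eqI) (auto simp: lookup_add lookup_minus lookup_single when_def)
  have d: "d = tdeg n" using Suc.hyps(2) unfolding m tdeg_add by simp
  obtain q where q: "q \<in> low (tdeg n)" "(X j - X k) * q = Poly_Mapping.single n 1 - K j k (Poly_Mapping.single n 1)"
    using Suc.hyps(1)[OF d] by blast
  let ?g = "Poly_Mapping.single n (1::complex)"
  have Xn: "Poly_Mapping.single m 1 = X i * ?g" unfolding m X_def by (simp add: mult_single)
  have KX: "K j k (Poly_Mapping.single m 1) = X (transpose j k i) * K j k ?g"
    unfolding m by (simp only: K_single map_key_transpose_add X_def mult_single map_key_transpose_single mult_1)
  define e :: mpoly where "e = (if i = j then 1 else if i = k then -1 else 0)"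
  have eX: "(X j - X k) * e = X i - X (transpose j k i)"
    by (auto simp: e_def transpose_def)
  define q' where "q' = e * ?g + X (transpose j k i) * q"
  have alg: "(a - b) * (e * g + c' * q) = c * g - c' * h"
    if "(a - b) * e = c - c'" "(a - b) * q = g - h" for a b c c' e g h q :: mpoly
  proof -
    have "(a - b) * (e * g + c' * q) = ((a - b) * e) * g + c' * ((a - b) * q)"
      by (simp only: distrib_left mult.assoc mult.left_commute)
    also have "\<dots> = c * g - c' * h"
      unfolding that by (simp add: left_diff_distrib right_diff_distrib)
    finally show ?thesis .
  qed
  have eq: "(X j - X k) * q' = Poly_Mapping.single m 1 - K j k (Poly_Mapping.single m 1)"
    unfolding q'_def KX unfolding Xn by (rule alg[OF eX q(2)])
  have g: "?g \<in> low (Suc d)" by (auto simp: low_def d)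
  have c: "e = Const (if i = j then 1 else if i = k then -1 else 0)"
    by (auto simp: e_def Const_def single_uminus)
  have "X (transpose j k i) \<in> low (Suc 1)" by (auto simp: low_def X_def)
  from low_mult[OF this q(1)] have "X (transpose j k i) * q \<in> low (Suc d)" by (simp add: d)
  then have "q' \<in> low (tdeg m)" unfolding q'_def c Suc.hyps(2)[symmetric]
    using g by (intro low_add low_Const_mult)
  then show ?case using eq by blast
qed

lemma mpoly_sum_monom: "p = (\<Sum>m \<in> Poly_Mapping.keys p. Const (Poly_Mapping.lookup p m) * Poly_Mapping.single m 1)"
  by (rule poly_mapping_eqI)
    (auto simp: Const_def mult_single lookup_sum lookup_single when_def in_keys_iff sum.delta)

lemma K_sum: "K i j (\<Sum>a \<in> A. f a) = (\<Sum>a \<in> A. K i j (f a))"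
  by (induction A rule: infinite_finite_induct) (auto simp: K_add)

lemma K_Const_mult: "K i j (Const c * Poly_Mapping.single m d) = Const c * K i j (Poly_Mapping.single m d)"
  by (simp add: Const_def mult_single K_single)

lemma divdiff_exists:
  assumes "p \<in> low (Suc d)"
  shows "\<exists>q \<in> low d. (X j - X k) * q = p - K j k p"
proof -
  obtain q where q: "\<And>m. q m \<in> low (tdeg m)"
    "\<And>m. (X j - X k) * q m = Poly_Mapping.single m 1 - K j k (Poly_Mapping.single m 1)"
    using divdiff_monom[of _ j k] by metis
  define Q where "Q = (\<Sum>m \<in> Poly_Mapping.keys p. Const (Poly_Mapping.lookup p m) * q m)"
  have "Q \<in> low d" unfolding Q_def
    using assms by (intro low_sum low_Const_mult low_mono[OF q(1)]) (auto simp: low_def)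
  moreover have "(X j - X k) * Q = p - K j k p"
  proof -
    have "(X j - X k) * Q = (\<Sum>m \<in> Poly_Mapping.keys p. Const (Poly_Mapping.lookup p m) * ((X j - X k) * q m))"
      by (simp add: Q_def sum_distrib_left mult.left_commute)
    also have "\<dots> = (\<Sum>m \<in> Poly_Mapping.keys p. Const (Poly_Mapping.lookup p m) * Poly_Mapping.single m 1)
        - K j k (\<Sum>m \<in> Poly_Mapping.keys p. Const (Poly_Mapping.lookup p m) * Poly_Mapping.single m 1)"
      by (simp add: q(2) K_sum K_Const_mult right_diff_distrib sum_subtractf)
    finally show ?thesis by (simp only: mpoly_sum_monom[symmetric])
  qed
  ultimately show ?thesis by blast
qed

lemma X_inj: "j \<noteq> k \<Longrightarrow> X j - X k \<noteq> 0"
proof -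
  assume "j \<noteq> k"
  then have "Poly_Mapping.single j (1::nat) \<noteq> Poly_Mapping.single k 1"
    by (metis lookup_single_eq lookup_single_not_eq zero_neq_one)
  then have "X j \<noteq> X k" unfolding X_def
    by (metis lookup_single_eq lookup_single_not_eq zero_neq_one)
  then show ?thesis by simp
qed

lemma divdiff_unique:
  assumes "j \<noteq> k" "(X j - X k) * q = p - K j k p"
  shows "divdiff j k p = q"
  unfolding divdiff_def
proof (rule the_equality)
  fix r assume "(X j - X k) * r = p - K j k p"
  then have "(X j - X k) * r = (X j - X k) * q" using assms(2) by simp
  then show "r = q" using X_inj[OF assms(1)] by simp
qed (rule assms)

lemma divdiff_low:
  assumes "j \<noteq> k" "p \<in> low (Suc d)"
  shows "divdiff j k p \<in> low d"
proof -
  obtain q where "q \<in> low d" "(X j - X k) * q = p - K j k p"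
    using divdiff_exists[OF assms(2)] by blast
  then show ?thesis using divdiff_unique[OF assms(1)] by simp
qed

lemma divdiff_eq:
  assumes "j \<noteq> k"
  shows "(X j - X k) * divdiff j k p = p - K j k p"
proof -
  obtain d where "p \<in> low d" using low_exists by blast
  then have "p \<in> low (Suc d)" by (rule low_mono) simp
  then obtain q where "(X j - X k) * q = p - K j k p"
    using divdiff_exists by blast
  then show ?thesis using divdiff_unique[OF assms] by simp
qed

lemma dunkl_low: "p \<in> low (Suc d) \<Longrightarrow> dunkl N \<beta> j p \<in> low d"
  unfolding dunkl_def
  by (intro low_add low_of_nat_mult low_sum pderiv_x_low divdiff_low) auto

lemma pderiv_x_0 [simp]: "pderiv_x i 0 = 0"
  by (simp add: pderiv_x_def)

lemma divdiff_0 [simp]: "j \<noteq> k \<Longrightarrow> divdiff j k 0 = 0"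
  by (rule divdiff_unique) auto

lemma dunkl_0 [simp]: "dunkl N \<beta> j 0 = 0"
  by (simp add: dunkl_def)

lemma laplacian_0 [simp]: "laplacian N \<beta> 0 = 0"
  by (simp add: laplacian_def numeral_2_eq_2)

lemma laplacian_low: "p \<in> low (Suc d) \<Longrightarrow> laplacian N \<beta> p \<in> low d"
  unfolding laplacian_def numeral_2_eq_2
  by (rule low_sum) (auto intro!: dunkl_low elim: low_mono)

lemma scale_0 [simp]: "scale c 0 = 0"
  by (rule poly_mapping_eqI) (simp add: scale_def lookup_coeffwise)

lemma finite_exp_Delta:
  "finite {k. scale (1 / fact k) (((\<lambda>G. scale c (Delta N \<beta> G)) ^^ k) F) \<noteq> 0}"
proof -
  let ?T = "\<lambda>G. scale c (Delta N \<beta> G)"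
  have lk: "Poly_Mapping.lookup (?T G) I = Const c * laplacian N \<beta> (Poly_Mapping.lookup G I)" for G I
    by (simp add: scale_def Delta_def lookup_coeffwise)
  have "\<forall>I. \<exists>d. Poly_Mapping.lookup F I \<in> low d" using low_exists by blast
  then obtain d where d: "\<And>I. Poly_Mapping.lookup F I \<in> low (d I)" by metis
  define D where "D = (\<Sum>I \<in> Poly_Mapping.keys F. d I)"
  have D: "Poly_Mapping.lookup F I \<in> low D" for I
  proof (cases "I \<in> Poly_Mapping.keys F")
    case True
    then show ?thesis unfolding D_def by (intro low_mono[OF d] member_le_sum) auto
  next
    case False
    then show ?thesis by (simp add: in_keys_iff)
  qed
  have step: "Poly_Mapping.lookup ((?T ^^ k) F) I \<in> low (D - k)" for k I
  proof (induction k)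
    case 0
    then show ?case by (simp add: D)
  next
    case (Suc k)
    show ?case
    proof (cases "D - k")
      case 0
      then show ?thesis using Suc by (simp add: lk)
    next
      case (Suc e)
      then have "D - Suc k = e" by simp
      then show ?thesis using Suc.IH unfolding Suc
        by (simp only: funpow.simps comp_apply lk) (intro low_Const_mult laplacian_low)
    qed
  qed
  have "(?T ^^ k) F = 0" if "k \<ge> D" for k
  proof (rule poly_mapping_eqI)
    fix I show "Poly_Mapping.lookup ((?T ^^ k) F) I = Poly_Mapping.lookup 0 I"
      using step[of k I] that by simp
  qed
  then have "scale (1 / fact k) ((?T ^^ k) F) = 0" if "k \<ge> D" for k
    using that by (simp add: scale_0)
  then have "{k. scale (1 / fact k) ((?T ^^ k) F) \<noteq> 0} \<subseteq> {..<D}"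
    using not_less by blast
  then show ?thesis using finite_subset by blast
qed

section \<open>Relations between \<open>theta\<close>, \<open>dtheta\<close> and \<open>kappa\<close>\<close>

lemma lookup_theta: "Poly_Mapping.lookup (theta i F) J = (if i \<in> J then theta_sign i J * Poly_Mapping.lookup F (J - {i}) else 0)"
  by (simp add: theta.rep_eq)

lemma lookup_dtheta: "Poly_Mapping.lookup (dtheta i F) J = (if i \<in> J then 0 else theta_sign i J * Poly_Mapping.lookup F (insert i J))"
  by (simp add: dtheta.rep_eq)

lemma lookup_kappa: "Poly_Mapping.lookup (kappa i j F) J =
   reorder_sign (transpose i j) (transpose i j ` J) * Poly_Mapping.lookup F (transpose i j ` J)"
  by (simp add: kappa.rep_eq)

lemma theta_sign_remove:
  "i \<in> J \<Longrightarrow> theta_sign j (J - {i}) = (if i < j then - theta_sign j J else theta_sign j J)"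
proof -
  assume i: "i \<in> J"
  show ?thesis
  proof (cases "i < j")
    case True
    have "{k \<in> J. k < j} = insert i {k \<in> J - {i}. k < j}" using i True by auto
    moreover have "finite {k \<in> J - {i}. k < j}" by simp
    ultimately have "card {k \<in> J. k < j} = Suc (card {k \<in> J - {i}. k < j})" by simp
    then show ?thesis using True unfolding theta_sign_def by simp
  next
    case False
    then have "{k \<in> J. k < j} = {k \<in> J - {i}. k < j}" by auto
    then show ?thesis using False unfolding theta_sign_def by simp
  qed
qed

lemma theta_sign_insert:
  "i \<notin> J \<Longrightarrow> theta_sign j (insert i J) = (if i < j then - theta_sign j J else theta_sign j J)"
  using theta_sign_remove[of i "insert i J" j] by (simp split: if_splits)

lemma theta_sign_sq [simp]: "theta_sign i J * (theta_sign i J * p) = p"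
  by (simp add: theta_sign_def flip: mult.assoc power_add)

lemma theta_anticomm: "theta i (theta j F) = - theta j (theta i F)"
proof (rule poly_mapping_eqI)
  fix J
  have "J - {i} - {j} = J - {j} - {i}" by auto
  then show "Poly_Mapping.lookup (theta i (theta j F)) J = Poly_Mapping.lookup (- theta j (theta i F)) J"
    by (cases "i = j"; cases "i < j"; cases "i \<in> J"; cases "j \<in> J")
      (simp_all add: lookup_theta theta_sign_remove mult.left_commute)
qed

lemma theta_sq: "theta i (theta i F) = 0"
  by (rule poly_mapping_eqI) (simp add: lookup_theta)

lemma dtheta_theta: "dtheta i (theta j F) = (if i = j then F else 0) - theta j (dtheta i F)"
proof (rule poly_mapping_eqI)
  fix J
  show "Poly_Mapping.lookup (dtheta i (theta j F)) J = Poly_Mapping.lookup ((if i = j then F else 0) - theta j (dtheta i F)) J"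
  proof (cases "i = j")
    case True
    have "insert i (J - {i}) = J" if "i \<in> J" using that by auto
    then show ?thesis using True
      by (cases "i \<in> J") (simp_all add: lookup_theta lookup_dtheta lookup_minus theta_sign_remove theta_sign_insert)
  next
    case False
    then have *: "insert i J - {j} = insert i (J - {j})" by auto
    show ?thesis using False
      by (cases "i < j"; cases "i \<in> J"; cases "j \<in> J")
        (simp_all add: lookup_theta lookup_dtheta lookup_minus theta_sign_remove theta_sign_insert * mult.left_commute)
  qed
qed

lemma dtheta_1: "dtheta i (Poly_Mapping.single {} p) = 0"
  by (rule poly_mapping_eqI) (auto simp: lookup_dtheta lookup_single when_def)

definition inversions :: "(nat \<Rightarrow> nat) \<Rightarrow> nat set \<Rightarrow> (nat \<times> nat) set" where
  "inversions w I = {(k, l). k \<in> I \<and> l \<in> I \<and> k < l \<and> w l < w k}"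

lemma finite_inversions_transpose: "finite (inversions (transpose i j) I)"
proof -
  have "inversions (transpose i j) I \<subseteq> {..max i j} \<times> {..max i j}"
  proof (rule subrelI)
    fix k l assume "(k, l) \<in> inversions (transpose i j) I"
    then have kl: "k < l" "transpose i j l < transpose i j k" by (auto simp: inversions_def)
    have "l \<le> max i j"
    proof (rule ccontr)
      assume "\<not> l \<le> max i j"
      then have "transpose i j l = l" "transpose i j k \<le> max l k" by (auto simp: transpose_def)
      then show False using kl by linarith
    qed
    then show "(k, l) \<in> {..max i j} \<times> {..max i j}" using kl(1) by simp
  qed
  then show ?thesis by (rule finite_subset) simp
qed

lemma kappa_1: "kappa i j (Poly_Mapping.single {} p) = Poly_Mapping.single {} p"
  by (rule poly_mapping_eqI) (auto simp: lookup_kappa lookup_single when_def reorder_sign_def)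

lemma reorder_sign_insert:
  assumes k: "k \<notin> I" and w: "inj w" and fin: "finite (inversions w (insert k I))"
  shows "reorder_sign w (insert k I) * theta_sign k I = theta_sign (w k) (w ` I) * reorder_sign w I"
proof -
  let ?A = "{l \<in> I. l < k \<and> w k < w l}" and ?B = "{l \<in> I. k < l \<and> w l < w k}"
  let ?C = "{l \<in> I. l < k \<and> w l < w k}"
  have eq: "inversions w (insert k I) = inversions w I \<union> ((\<lambda>l. (l, k)) ` ?A \<union> (\<lambda>l. (k, l)) ` ?B)"
    by (auto simp: inversions_def)
  have f: "finite (inversions w I)" "finite ?A" "finite ?B"
    using fin unfolding eq by (auto dest: finite_imageD simp: inj_on_def)
  have "card (inversions w (insert k I)) = card (inversions w I) + card ((\<lambda>l. (l, k)) ` ?A \<union> (\<lambda>l. (k, l)) ` ?B)"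
    unfolding eq by (rule card_Un_disjoint) (use f k in \<open>auto simp: inversions_def\<close>)
  also have "card ((\<lambda>l. (l, k)) ` ?A \<union> (\<lambda>l. (k, l)) ` ?B) = card ((\<lambda>l. (l, k)) ` ?A) + card ((\<lambda>l. (k, l)) ` ?B)"
    by (rule card_Un_disjoint) (use f k in auto)
  also have "card ((\<lambda>l. (l, k)) ` ?A) = card ?A" by (rule card_image) (auto simp: inj_on_def)
  also have "card ((\<lambda>l. (k, l)) ` ?B) = card ?B" by (rule card_image) (auto simp: inj_on_def)
  finally have c: "card (inversions w (insert k I)) = card (inversions w I) + (card ?A + card ?B)" .
  have neq: "w l \<noteq> w k" if "l \<in> I" for l using that k w by (auto dest: injD)
  have "{l \<in> I. l < k} = ?A \<union> ?C" using neq by (auto simp: neq_iff)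
  then have "card {l \<in> I. l < k} = card (?A \<union> ?C)" by (rule arg_cong)
  also have "card (?A \<union> ?C) = card ?A + card ?C" by (rule card_Un_disjoint) auto
  finally have c1: "card {l \<in> I. l < k} = card ?A + card ?C" .
  have "?B \<union> ?C = {l \<in> I. w l < w k}" using k by (auto simp: neq_iff) (metis nat_neq_iff)
  then have "{l \<in> w ` I. l < w k} = w ` (?B \<union> ?C)" by auto
  then have "card {l \<in> w ` I. l < w k} = card (?B \<union> ?C)"
    by (simp only: card_image[OF inj_on_subset[OF w subset_UNIV]])
  also have "card (?B \<union> ?C) = card ?B + card ?C" by (rule card_Un_disjoint) (use f in auto)
  finally have c2: "card {l \<in> w ` I. l < w k} = card ?B + card ?C" .
  show ?thesis
    unfolding reorder_sign_def theta_sign_def inversions_def[symmetric] c c1 c2 power_add[symmetric]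
    by (auto simp: minus_one_power_iff)
qed

lemma kappa_theta: "kappa i j (theta k F) = theta (transpose i j k) (kappa i j F)"
proof (rule poly_mapping_eqI)
  fix J
  let ?s = "transpose i j"
  show "Poly_Mapping.lookup (kappa i j (theta k F)) J = Poly_Mapping.lookup (theta (?s k) (kappa i j F)) J"
  proof (cases "k \<in> ?s ` J")
    case True
    define I where "I = ?s ` J - {k}"
    have I: "?s ` J = insert k I" "k \<notin> I" using True by (auto simp: I_def)
    have J: "J = ?s ` insert k I" by (simp flip: I(1) add: image_comp)
    have J': "J - {?s k} = ?s ` I" using I(2) unfolding J by (auto dest: injD[OF inj_transpose])
    have kJ: "?s k \<in> J" by (subst J) simp
    have ts1: "theta_sign k (insert k I) = theta_sign k I" using theta_sign_insert[OF I(2), of k] by simp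
    have ts2: "theta_sign (?s k) J = theta_sign (?s k) (?s ` I)"
      using theta_sign_remove[OF kJ, of "?s k"] by (simp add: J')
    note ts = ts1 ts2
    have im: "?s ` ?s ` I = I" by (simp add: image_comp)
    have "Poly_Mapping.lookup (kappa i j (theta k F)) J =
        reorder_sign ?s (insert k I) * theta_sign k I * Poly_Mapping.lookup F I"
      using I by (simp add: lookup_kappa lookup_theta ts mult.assoc)
    also have "\<dots> = Poly_Mapping.lookup (theta (?s k) (kappa i j F)) J"
      using kJ by (simp add: lookup_kappa lookup_theta ts J' im mult.assoc
        reorder_sign_insert[OF I(2) inj_transpose finite_inversions_transpose])
    finally show ?thesis .
  next
    case False
    then have "?s k \<notin> J" by (metis imageI transpose_involutory)
    then show ?thesis using False by (simp add: lookup_kappa lookup_theta)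
  qed
qed

section \<open>Decompositions into simple transpositions\<close>

lemma word_perm_Cons [simp]: "word_perm (i # is) = transpose i (Suc i) \<circ> word_perm is"
  by (simp add: word_perm_def)

lemma word_perm_Nil [simp]: "word_perm [] = id"
  by (simp add: word_perm_def)

lemma word_perm_append: "word_perm (is @ js) = word_perm is \<circ> word_perm js"
  by (induction "is") (auto simp: comp_assoc)

lemma word_perm_rev: "word_perm is \<circ> word_perm (rev is) = id"
proof (induction "is")
  case (Cons i "is")
  have "word_perm (i # is) \<circ> word_perm (rev (i # is)) =
      transpose i (Suc i) \<circ> (word_perm is \<circ> word_perm (rev is)) \<circ> transpose i (Suc i)"
    by (simp add: word_perm_append comp_assoc)
  also have "\<dots> = id" unfolding Cons by simp
  finally show ?case .
qed simp

lemma bij_word_perm: "bij (word_perm is)"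
  by (induction "is") (simp_all del: id_apply comp_apply add: bij_comp)

lemma word_perm_permutes: "set is \<subseteq> {1..<N} \<Longrightarrow> word_perm is permutes {1..N}"
  by (induction "is") (auto intro!: permutes_compose permutes_swap_id simp: permutes_id)

lemma word_perm_cycle: "a \<le> n \<Longrightarrow> word_perm [a..<n] n = a"
  by (induction n) (auto simp: le_Suc_eq word_perm_append)

lemma word_perm_exists:
  "w permutes {1..N} \<Longrightarrow> \<exists>is. set is \<subseteq> {1..<N} \<and> word_perm is = w"
proof (induction N arbitrary: w)
  case 0
  then show ?case by (intro exI[of _ "[]"]) auto
next
  case (Suc N)
  define a where "a = w (Suc N)"
  have a: "1 \<le> a" "a \<le> Suc N"
    using permutes_in_image[OF Suc.prems, of "Suc N"] by (auto simp: a_def)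
  define c where "c = [a..<Suc N]"
  define v where "v = word_perm (rev c) \<circ> w"
  have cv: "word_perm c \<circ> v = w"
    by (simp add: v_def word_perm_rev flip: comp_assoc)
  have rc: "word_perm (rev c) \<circ> word_perm c = id"
    using word_perm_rev[of "rev c"] by simp
  have "set c \<subseteq> {1..<Suc N}" using a by (auto simp: c_def)
  then have "v permutes {1..Suc N}" unfolding v_def
    by (intro permutes_compose[OF Suc.prems] word_perm_permutes) simp
  moreover have "v (Suc N) = Suc N"
    using word_perm_cycle[OF a(2)] fun_cong[OF rc, of "Suc N"] by (simp add: v_def a_def c_def)
  ultimately have "v permutes {1..N}"
    by (rule_tac permutes_superset) (auto simp: atLeastAtMostSuc_conv)
  then obtain js where js: "set js \<subseteq> {1..<N}" "word_perm js = v" using Suc.IH by blast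
  show ?case
  proof (intro exI conjI)
    show "set (c @ js) \<subseteq> {1..<Suc N}" using js(1) a by (auto simp: c_def)
    show "word_perm (c @ js) = w" by (simp add: word_perm_append js cv)
  qed
qed

lemma inversions_simple:
  assumes "bij w" "finite (inversions w I)"
  shows "finite (inversions (transpose i (Suc i) \<circ> w) I) \<and>
    reorder_sign (transpose i (Suc i) \<circ> w) I = reorder_sign (transpose i (Suc i)) (w ` I) * reorder_sign w I"
proof -
  let ?s = "transpose i (Suc i)"
  have inv: "inversions ?s J = (if i \<in> J \<and> Suc i \<in> J then {(i, Suc i)} else {})" for J
    by (auto simp: inversions_def transpose_def split: if_splits)
  obtain a b where ab: "w a = i" "w b = Suc i" using bij_is_surj[OF assms(1)] by (metis surjD)
  have inj: "w k = w l \<longleftrightarrow> k = l" for k l using assms(1) by (metis bij_is_inj injD)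
  have s: "?s m < ?s n \<longleftrightarrow> (if m = i \<and> n = Suc i then False else if m = Suc i \<and> n = i then True else m < n)" for m n
    by (auto simp: transpose_def)
  have mem: "k = a \<longleftrightarrow> w k = i" "k = b \<longleftrightarrow> w k = Suc i" for k using ab inj by metis+
  have img: "i \<in> w ` I \<longleftrightarrow> a \<in> I" "Suc i \<in> w ` I \<longleftrightarrow> b \<in> I"
    using ab inj by (metis imageE imageI)+
  consider "\<not> (a \<in> I \<and> b \<in> I)" | "a \<in> I" "b \<in> I" "a < b" | "a \<in> I" "b \<in> I" "b < a"
    using ab by (metis n_not_Suc_n nat_neq_iff)
  then show ?thesis
  proof cases
    case 1
    then have "inversions (?s \<circ> w) I = inversions w I"
      unfolding inversions_def comp_apply s by (auto simp: mem[symmetric])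
    then show ?thesis using assms(2) 1
      unfolding reorder_sign_def inversions_def[symmetric] inv img by (auto simp del: comp_apply simp: comp_def)
  next
    case 2
    then have e: "inversions (?s \<circ> w) I = insert (a, b) (inversions w I)"
      unfolding inversions_def comp_apply s by (auto simp: mem[symmetric] ab)
    have "(a, b) \<notin> inversions w I" using ab by (auto simp: inversions_def)
    then show ?thesis using assms(2) 2
      unfolding reorder_sign_def inversions_def[symmetric] inv img e by (simp add: comp_def)
  next
    case 3
    then have e: "inversions w I = insert (b, a) (inversions (?s \<circ> w) I)"
      unfolding inversions_def comp_apply s by (auto simp: mem[symmetric] ab)
    have "(b, a) \<notin> inversions (?s \<circ> w) I" using ab by (auto simp: inversions_def)
    then show ?thesis using assms(2) 3
      unfolding reorder_sign_def inversions_def[symmetric] inv img e by (simp add: comp_def)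
  qed
qed

lemma K_reorder_sign: "K i j (reorder_sign w I * p) = reorder_sign w I * K i j p"
  by (cases "even (card {(k, l). k \<in> I \<and> l \<in> I \<and> k < l \<and> w l < w k})")
    (auto simp: reorder_sign_def minus_one_power_iff intro!: poly_mapping_eqI)

lemma inj_map_key: "bij w \<Longrightarrow> inj (Poly_Mapping.map_key w :: (nat \<Rightarrow>\<^sub>0 nat) \<Rightarrow> _)"
  by (rule injI, rule poly_mapping_eqI)
    (metis bij_is_inj bij_is_surj comp_apply map_key.rep_eq surjD)

lemma map_key_comp_lookup: "bij (w :: nat \<Rightarrow> nat) \<Longrightarrow> Poly_Mapping.lookup (Poly_Mapping.map_key (Poly_Mapping.map_key w) (p::mpoly)) m
   = Poly_Mapping.lookup p (Poly_Mapping.map_key w m)"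
  by (subst map_key.rep_eq) (simp_all add: inj_map_key)

lemma lookup_calK_word:
  "finite (inversions (word_perm is) I) \<and>
   Poly_Mapping.lookup (calK_word is F) (word_perm is ` I) =
     reorder_sign (word_perm is) I *
       Poly_Mapping.map_key (Poly_Mapping.map_key (word_perm is)) (Poly_Mapping.lookup F I)"
proof (induction "is")
  case Nil
  have "inversions id I = {}" by (auto simp: inversions_def)
  moreover have "Poly_Mapping.map_key id = (id :: (nat \<Rightarrow>\<^sub>0 nat) \<Rightarrow> _)"
    by (rule ext, rule poly_mapping_eqI) (simp add: map_key.rep_eq)
  moreover have "Poly_Mapping.map_key id p = p" for p :: mpoly
    by (rule poly_mapping_eqI) (simp add: map_key.rep_eq)
  ultimately show ?case by (simp add: calK_word_def reorder_sign_def id_def flip: inversions_def)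
next
  case (Cons i "is")
  let ?s = "transpose i (Suc i)" and ?w = "word_perm is"
  have K: "K i (Suc i) (Poly_Mapping.map_key (Poly_Mapping.map_key ?w) p) =
      Poly_Mapping.map_key (Poly_Mapping.map_key (?s \<circ> ?w)) p" for p :: mpoly
  proof (rule poly_mapping_eqI)
    fix m :: "nat \<Rightarrow>\<^sub>0 nat"
    have "Poly_Mapping.map_key ?w (Poly_Mapping.map_key ?s m) = Poly_Mapping.map_key (?s \<circ> ?w) m"
      by (rule map_key_compose) (auto simp: bij_is_inj[OF bij_word_perm])
    then show "Poly_Mapping.lookup (K i (Suc i) (Poly_Mapping.map_key (Poly_Mapping.map_key ?w) p)) m =
      Poly_Mapping.lookup (Poly_Mapping.map_key (Poly_Mapping.map_key (?s \<circ> ?w)) p) m"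
      using bij_word_perm[of "is"] bij_word_perm[of "i # is"] by (simp add: map_key_comp_lookup)
  qed
  have im: "?s ` (?s \<circ> ?w) ` I = ?w ` I" by (simp add: image_comp flip: comp_assoc)
  have "Poly_Mapping.lookup (calK_word (i # is) F) (word_perm (i # is) ` I) =
      reorder_sign ?s (?w ` I) * K i (Suc i) (Poly_Mapping.lookup (calK_word is F) (?w ` I))"
    using im by (simp add: calK_word_def calK_def lookup_kappa lookup_coeffwise)
  also have "\<dots> = reorder_sign ?s (?w ` I) * (reorder_sign ?w I *
      Poly_Mapping.map_key (Poly_Mapping.map_key (?s \<circ> ?w)) (Poly_Mapping.lookup F I))"
    by (simp only: Cons K_reorder_sign K)
  finally show ?case
    using inversions_simple[OF bij_word_perm, of "is" I i] Cons
    by (simp only: word_perm_Cons mult.assoc simp_thms)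
qed

lemma calK_word_cong:
  assumes "word_perm is = word_perm js"
  shows "calK_word is F = calK_word js F"
proof (rule poly_mapping_eqI)
  fix J
  have "J = word_perm is ` (inv (word_perm is) ` J)"
    by (simp add: image_f_inv_f bij_is_surj[OF bij_word_perm])
  then show "Poly_Mapping.lookup (calK_word is F) J = Poly_Mapping.lookup (calK_word js F) J"
    using lookup_calK_word[of "is" "inv (word_perm is) ` J" F]
      lookup_calK_word[of js "inv (word_perm is) ` J" F] assms by simp
qed

lemma calK_perm_eq:
  assumes "set is \<subseteq> {1..<N}" "word_perm is = w"
  shows "calK_perm N w F = calK_word is F"
proof -
  have "word_perm (SOME is. set is \<subseteq> {1..<N} \<and> word_perm is = w) = w"
    by (rule someI2[of _ "is"]) (use assms in auto)
  then show ?thesis unfolding calK_perm_def using assms(2) by (intro calK_word_cong) simp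
qed

end

theory Submission
  imports Defs
begin

text \<open>
  Write \<open>\<C>\<^sub>j\<close> for the Cherednik operator.  Then
  \<open>\<C>\<^sub>j = x\<^sub>j D\<^sub>j + \<beta> \<Sum>\<^sub>k\<^sub>>\<^sub>j K\<^sub>j\<^sub>k - \<beta>(N-1)\<close>, so the deformed operator is \<open>\<C>\<^sub>j - D\<^sub>j\<^sup>2 / (2\<omega>)\<close>.
  The relations \<open>[D\<^sub>i, D\<^sub>j] = 0\<close> and \<open>[\<Delta>, x\<^sub>j] = 2 D\<^sub>j\<close>, and the invariance of \<open>\<Delta>\<close> under the \<open>K\<^sub>j\<^sub>k\<close>, give
  \<open>[\<Delta>, \<C>\<^sub>j] = 2 D\<^sub>j\<^sup>2\<close>, which commutes with \<open>\<Delta>\<close>.  Hence conjugation by the exponential of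
  \<open>\<Delta> / (4\<omega>)\<close> stops after the first commutator and turns \<open>\<C>\<^sub>j\<close> into the deformed operator.  The
  exponential also commutes with \<open>\<theta>\<^sub>i\<close>, its derivative and the symmetric group.
\<close>

section \<open>Linear operators on polynomials\<close>

lemma Const_add: "Const (a + b) = Const a + Const b"
  by (simp add: Const_def single_add)

lemma Const_mult: "Const (a * b) = Const a * Const b"
  by (simp add: Const_def mult_single)

lemma Const_0 [simp]: "Const 0 = 0"
  by (simp add: Const_def)

lemma Const_1 [simp]: "Const 1 = 1"
  by (simp add: Const_def)

lemma Const_sum: "Const (\<Sum>a \<in> A. f a) = (\<Sum>a \<in> A. Const (f a))"
  by (induction A rule: infinite_finite_induct) (auto simp: Const_add)

lemma mpoly_single_induct [case_names single add]:
  fixes p :: mpoly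
  assumes "\<And>m c. P (Poly_Mapping.single m c)" "\<And>p q. P p \<Longrightarrow> P q \<Longrightarrow> P (p + q)"
  shows "P p"
proof -
  have "P (\<Sum>m \<in> A. Const (Poly_Mapping.lookup p m) * Poly_Mapping.single m 1)" for A
    by (induction A rule: infinite_finite_induct)
      (use assms assms(1)[of 0 0] in \<open>simp_all add: Const_def mult_single\<close>)
  from this[of "Poly_Mapping.keys p"] show ?thesis by (simp only: mpoly_sum_monom[symmetric])
qed

text \<open>Monomials are built up one variable at a time, by induction on total degree. This form
  suits commutators: an additive operator that kills constants and commutes with every variable
  vanishes.\<close>

lemma mpoly_induct [case_names Const add X]:
  assumes C: "\<And>c. P (Const c)"
    and A: "\<And>p q. P p \<Longrightarrow> P q \<Longrightarrow> P (p + q)"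
    and M: "\<And>i p. P p \<Longrightarrow> P (X i * p)"
  shows "P p"
proof -
  have mon: "P (Poly_Mapping.single m c)" for m c
  proof (induction "tdeg m" arbitrary: m)
    case 0
    then have "m = 0" by (auto simp: tdeg_def in_keys_iff intro: poly_mapping_eqI)
    then show ?case using C by (simp add: Const_def)
  next
    case (Suc d)
    then obtain i where i: "Poly_Mapping.lookup m i \<noteq> 0"
      by (metis Zero_not_Suc sum.neutral tdeg_def)
    define n where "n = m - Poly_Mapping.single i 1"
    have m: "m = Poly_Mapping.single i 1 + n"
      using i unfolding n_def
      by (intro poly_mapping_eqI) (auto simp: lookup_add lookup_minus lookup_single when_def)
    have "d = tdeg n" using Suc.hyps(2) unfolding m tdeg_add by simp
    then have "P (X i * Poly_Mapping.single n c)" using Suc.hyps(1) M by blast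
    then show ?case by (simp add: m X_def mult_single)
  qed
  show ?thesis
    by (induction p rule: mpoly_single_induct) (auto intro: mon A)
qed

text \<open>Linearity is over the complex numbers, embedded by \<open>Const\<close>, and not over
  polynomials. As an instance of \<open>module_hom\<close> it inherits the rules for zero, negation,
  differences and sums.\<close>

abbreviation lin :: "(mpoly \<Rightarrow> mpoly) \<Rightarrow> bool" where
  "lin \<equiv> module_hom (\<lambda>c p. Const c * p) (\<lambda>c p. Const c * p)"

lemma module_mpoly: "module (\<lambda>c p :: mpoly. Const c * p)"
  by unfold_locales (simp_all add: Const_add Const_mult algebra_simps)

lemma linI:
  "(\<And>p q. T (p + q) = T p + T q) \<Longrightarrow> (\<And>c p. T (Const c * p) = Const c * T p) \<Longrightarrow> lin T"
  by (intro module_hom.intro module_mpoly module_hom_axioms.intro)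

lemma lin_scale: "lin T \<Longrightarrow> T (Const c * p) = Const c * T p"
  by (rule module_hom.scale)

lemma lin_add: "lin T \<Longrightarrow> T (p + q) = T p + T q"
  by (rule module_hom.add)

lemmas lin_zero = module_hom.zero
  and lin_neg = module_hom.neg
  and lin_diff = module_hom.diff
  and lin_sum = module_hom.sum

lemma lin_of_nat: "lin T \<Longrightarrow> T (of_nat n * p) = of_nat n * T p"
  by (simp add: of_nat_Const lin_scale)

lemma lin_mult: "lin T \<Longrightarrow> lin (\<lambda>p. q * T p)"
  by (rule linI) (simp_all only: lin_add lin_scale distrib_left mult.left_commute)

lemma lin_compose: "lin S \<Longrightarrow> lin T \<Longrightarrow> lin (\<lambda>p. S (T p))"
  by (rule linI) (simp_all only: lin_add lin_scale)

lemma lin_plus: "lin S \<Longrightarrow> lin T \<Longrightarrow> lin (\<lambda>p. S p + T p)"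
  by (rule linI) (simp_all only: lin_add lin_scale distrib_left add_ac)

lemma lin_minus: "lin S \<Longrightarrow> lin T \<Longrightarrow> lin (\<lambda>p. S p - T p)"
  by (rule linI) (simp_all only: lin_add lin_scale right_diff_distrib add_diff_add)

lemma lin_summation: "(\<And>a. a \<in> A \<Longrightarrow> lin (T a)) \<Longrightarrow> lin (\<lambda>p. \<Sum>a \<in> A. T a p)"
  by (rule linI, unfold sum.distrib[symmetric] sum_distrib_left; rule sum.cong)
    (simp_all only: lin_add lin_scale)

lemma lin_ident: "lin (\<lambda>p. p)"
  by (rule linI) simp_all

lemma lin_funpow: "lin T \<Longrightarrow> lin (T ^^ k)"
  by (induction k) (simp_all add: lin_ident id_def comp_def lin_compose)

section \<open>Exchange operators as algebra automorphisms\<close>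

lemma K_mult: "K i j (p * q) = K i j p * K i j q"
proof (induction p rule: mpoly_single_induct)
  case (single m c)
  show ?case
    by (induction q rule: mpoly_single_induct)
      (simp_all add: mult_single K_single map_key_transpose_add distrib_left K_add)
qed (simp add: distrib_right K_add)

lemma K_Const [simp]: "K i j (Const c) = Const c"
  by (simp add: Const_def K_single inj_transpose)

lemma lin_K: "lin (K i j)"
  by (rule linI) (simp_all add: K_add K_mult)

lemma K_commute: "K i j = K j i"
  by (simp add: K_def transpose_commute)

text \<open>Conjugating a transposition by s = (i j) relabels its two points by s.\<close>

lemma K_conj: "K i j (K k l p) = K (transpose i j k) (transpose i j l) (K i j p)"
proof -
  have "transpose (transpose i j k) (transpose i j l) (transpose i j x) = transpose i j (transpose k l x)" for x
    by (auto simp: transpose_def)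
  then show ?thesis
    by (intro poly_mapping_eqI, unfold lookup_K)
      (intro arg_cong[where f = "Poly_Mapping.lookup p"] poly_mapping_eqI, simp)
qed

section \<open>Coefficients and partial derivatives\<close>

lemma lookup_Const_mult: "Poly_Mapping.lookup (Const c * p) m = c * Poly_Mapping.lookup p m"
  by (induction p rule: mpoly_single_induct)
    (simp_all add: Const_def mult_single lookup_single lookup_add when_def distrib_left)

text \<open>The sum defining \<open>pderiv_x\<close> ranges over the support of p, which is awkward
  for sums of polynomials; coefficients turn linearity and equivariance into pointwise
  identities.\<close>

lemma lookup_pderiv_x:
  "Poly_Mapping.lookup (pderiv_x i p) m =
     of_nat (Suc (Poly_Mapping.lookup m i)) * Poly_Mapping.lookup p (m + Poly_Mapping.single i 1)"
proof -
  let ?e = "Poly_Mapping.single i (1::nat)"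
  have "(of_nat (Poly_Mapping.lookup m' i) * Poly_Mapping.lookup p m' when m' - ?e = m) =
      (if m' = m + ?e then of_nat (Suc (Poly_Mapping.lookup m i)) * Poly_Mapping.lookup p (m + ?e) else 0)" for m'
  proof (cases "m' = m + ?e")
    case False
    \<comment> \<open>Subtraction of exponents is truncated, so a second monomial may also be sent
      to m; it does not contain the variable i, and the factor in front kills it.\<close>
    have "Poly_Mapping.lookup m' i = 0" if "m' - ?e = m"
    proof (rule ccontr)
      assume "Poly_Mapping.lookup m' i \<noteq> 0"
      then have "m' = (m' - ?e) + ?e"
        by (intro poly_mapping_eqI) (auto simp: lookup_add lookup_minus lookup_single when_def)
      then show False using that False by simp
    qed
    then show ?thesis using False by (auto simp: when_def)
  qed (simp add: lookup_add)
  then show ?thesis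
    by (simp add: pderiv_x_def lookup_sum lookup_single sum.delta in_keys_iff)
qed

lemma lin_pderiv_x: "lin (pderiv_x i)"
proof (rule linI)
  show "pderiv_x i (Const c * p) = Const c * pderiv_x i p" for c p
    by (rule poly_mapping_eqI) (simp add: lookup_pderiv_x lookup_Const_mult)
qed (rule poly_mapping_eqI, simp add: lookup_pderiv_x lookup_add algebra_simps)

lemma pderiv_x_single:
  "pderiv_x i (Poly_Mapping.single m c) =
     Poly_Mapping.single (m - Poly_Mapping.single i 1) (of_nat (Poly_Mapping.lookup m i) * c)"
  by (cases "c = 0") (simp_all add: pderiv_x_def)

lemma pderiv_x_Const [simp]: "pderiv_x i (Const c) = 0"
  by (simp add: Const_def pderiv_x_single)

lemma pderiv_x_X_mult: "pderiv_x i (X k * p) = X k * pderiv_x i p + (if k = i then p else 0)"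
proof (induction p rule: mpoly_single_induct)
  case (single m c)
  let ?e = "Poly_Mapping.single k (1::nat)" and ?f = "Poly_Mapping.single i (1::nat)"
  show ?case
  proof (cases "Poly_Mapping.lookup m i = 0")
    case True
    then show ?thesis
      by (auto simp: X_def mult_single pderiv_x_single lookup_add lookup_single when_def)
  next
    case False
    \<comment> \<open>With truncated subtraction this regrouping relies on variable i occurring in
      m; the other case was settled separately.\<close>
    then have "?e + m - ?f = ?e + (m - ?f)"
      by (intro poly_mapping_eqI) (auto simp: lookup_add lookup_minus lookup_single when_def)
    moreover have "?f + (m - ?f) = m" using False
      by (intro poly_mapping_eqI) (auto simp: lookup_add lookup_minus lookup_single when_def)
    ultimately show ?thesis
      by (auto simp: X_def mult_single pderiv_x_single lookup_add lookup_single when_def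
          single_add distrib_right)
  qed
next
  case (add p q)
  then show ?case by (simp add: lin_add[OF lin_pderiv_x] distrib_left)
qed

lemma K_pderiv_x: "K i j (pderiv_x k p) = pderiv_x (transpose i j k) (K i j p)"
  by (rule poly_mapping_eqI)
    (simp add: lookup_pderiv_x map_key_transpose_add map_key_transpose_single)

section \<open>Divided differences\<close>

lemma lin_divdiff:
  assumes "j \<noteq> k"
  shows "lin (divdiff j k)"
\<comment> \<open>The quotient is characterised by uniqueness, so each claimed value is checked
  after multiplication by \<open>X j - X k\<close>. The next lemmas follow the same pattern.\<close>
proof (rule linI; rule divdiff_unique[OF assms])
  show "(X j - X k) * (divdiff j k p + divdiff j k q) = p + q - K j k (p + q)" for p q
    by (simp add: distrib_left K_add divdiff_eq[OF assms])
  have "(X j - X k) * (Const c * divdiff j k p) = Const c * ((X j - X k) * divdiff j k p)" for c p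
    by (rule mult.left_commute)
  then show "(X j - X k) * (Const c * divdiff j k p) = Const c * p - K j k (Const c * p)" for c p
    by (simp only: divdiff_eq[OF assms] K_mult K_Const right_diff_distrib)
qed

lemma divdiff_Const [simp]: "j \<noteq> k \<Longrightarrow> divdiff j k (Const c) = 0"
  by (rule divdiff_unique) auto

text \<open>Twisted Leibniz rule. With K = K_jk, x_l p - K(x_l p) = x_l (p - K p) + (x_l - K x_l) K
  p, and the quotient of x_l - K x_l by x_j - x_k is 1, -1 or 0.\<close>

lemma divdiff_X_mult:
  assumes "j \<noteq> k"
  shows "divdiff j k (X l * p) =
    X l * divdiff j k p + (if l = j then K j k p else if l = k then - K j k p else 0)"
proof (rule divdiff_unique[OF assms])
  have "(X j - X k) * (X l * divdiff j k p) = X l * (p - K j k p)"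
    by (simp only: divdiff_eq[OF assms, symmetric] mult.left_commute)
  then show "(X j - X k) * (X l * divdiff j k p + (if l = j then K j k p else if l = k then - K j k p else 0)) =
      X l * p - K j k (X l * p)"
    using assms by (auto simp: distrib_left K_mult K_X algebra_simps)
qed

lemma K_divdiff:
  assumes "k \<noteq> l"
  shows "K i j (divdiff k l p) = divdiff (transpose i j k) (transpose i j l) (K i j p)"
proof (rule sym, rule divdiff_unique)
  show "transpose i j k \<noteq> transpose i j l" using assms by (auto dest: injD[OF inj_transpose])
  have "(X (transpose i j k) - X (transpose i j l)) * K i j (divdiff k l p) =
      K i j ((X k - X l) * divdiff k l p)"
    by (simp add: K_mult lin_diff[OF lin_K] K_X)
  then show "(X (transpose i j k) - X (transpose i j l)) * K i j (divdiff k l p) =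
      K i j p - K (transpose i j k) (transpose i j l) (K i j p)"
    by (simp add: divdiff_eq[OF assms] lin_diff[OF lin_K] K_conj[of i j k l p])
qed

section \<open>Commutation relations of the Dunkl operators\<close>

lemma lin_dunkl: "lin (dunkl N \<beta> j)"
  unfolding dunkl_def
  by (intro lin_plus lin_mult lin_summation lin_pderiv_x lin_divdiff) auto

text \<open>\<open>dunkl_X_comm N \<beta> j k\<close> is the commutator \<open>[D\<^sub>j, x\<^sub>k]\<close>.\<close>

definition dunkl_X_comm :: "nat \<Rightarrow> nat \<Rightarrow> nat \<Rightarrow> nat \<Rightarrow> mpoly \<Rightarrow> mpoly" where
  "dunkl_X_comm N \<beta> j k p =
     (if k = j then p + of_nat \<beta> * (\<Sum>l \<in> {1..N} - {j}. K j l p)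
      else if k \<in> {1..N} then - (of_nat \<beta> * K j k p) else 0)"

lemma dunkl_X_mult: "dunkl N \<beta> j (X k * p) = X k * dunkl N \<beta> j p + dunkl_X_comm N \<beta> j k p"
proof -
  have "(\<Sum>l \<in> {1..N} - {j}. divdiff j l (X k * p)) =
      (\<Sum>l \<in> {1..N} - {j}. X k * divdiff j l p) +
      (\<Sum>l \<in> {1..N} - {j}. if k = j then K j l p else if k = l then - K j l p else 0)"
    unfolding sum.distrib[symmetric]
    by (intro sum.cong) (auto simp: divdiff_X_mult)
  also have "(\<Sum>l \<in> {1..N} - {j}. if k = j then K j l p else if k = l then - K j l p else 0) =
      (if k = j then \<Sum>l \<in> {1..N} - {j}. K j l p else if k \<in> {1..N} then - K j k p else 0)"
    by (simp add: sum.delta)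
  finally show ?thesis
    by (simp add: dunkl_def dunkl_X_comm_def pderiv_x_X_mult distrib_left sum_distrib_left
        mult.left_commute)
qed

lemma dunkl_Const [simp]: "dunkl N \<beta> j (Const c) = 0"
  by (simp add: dunkl_def)

lemma transpose_image_interval_diff:
  assumes "i \<in> {1..N}" "j \<in> {1..N}"
  shows "transpose i j ` ({1..N} - {k}) = {1..N} - {transpose i j k}"
proof -
  have "transpose i j ` {1..N} = {1..N}"
    by (rule permutes_image[OF permutes_swap_id]) (use assms in auto)
  then show ?thesis by (simp add: image_set_diff[OF inj_transpose])
qed

text \<open>The exchange relabels the sum over l. The bounds on i and j make the transposition
  preserve \<open>{1..N}\<close>, so the result is again a Dunkl operator.\<close>

lemma K_dunkl:
  assumes "i \<in> {1..N}" "j \<in> {1..N}"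
  shows "K i j (dunkl N \<beta> k p) = dunkl N \<beta> (transpose i j k) (K i j p)"
proof -
  have "(\<Sum>l \<in> {1..N} - {k}. K i j (divdiff k l p)) =
      (\<Sum>l \<in> {1..N} - {k}. divdiff (transpose i j k) (transpose i j l) (K i j p))"
    by (intro sum.cong) (auto simp: K_divdiff)
  also have "\<dots> = (\<Sum>l \<in> transpose i j ` ({1..N} - {k}). divdiff (transpose i j k) l (K i j p))"
    by (simp add: sum.reindex inj_on_subset[OF inj_transpose])
  finally show ?thesis
    by (simp only: dunkl_def K_add lin_of_nat[OF lin_K] K_pderiv_x K_sum
        transpose_image_interval_diff[OF assms])
qed

lemma K_dunkl_other:
  "i \<in> {1..N} \<Longrightarrow> j \<in> {1..N} \<Longrightarrow> k \<noteq> i \<Longrightarrow> k \<noteq> j \<Longrightarrow>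
    K i j (dunkl N \<beta> k p) = dunkl N \<beta> k (K i j p)"
  by (simp add: K_dunkl)

text \<open>By K_ij D_j = D_i K_ij and K_ij D_i = D_j K_ij the terms with K_ij cancel on each side.
  What remains on both is D_i p plus beta times the sum of K_jl D_i p over l other than i and
  j.\<close>

lemma dunkl_X_comm_symmetric_aux:
  assumes "i \<in> {1..N}" "j \<in> {1..N}" "i \<noteq> j"
  shows "dunkl_X_comm N \<beta> i j (dunkl N \<beta> j p) + dunkl N \<beta> i (dunkl_X_comm N \<beta> j j p) =
    dunkl_X_comm N \<beta> j j (dunkl N \<beta> i p) + dunkl N \<beta> j (dunkl_X_comm N \<beta> i j p)"
proof -
  let ?D = "dunkl N \<beta>" and ?b = "of_nat \<beta> :: mpoly"
  let ?A = "{1..N} - {j} - {i}"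
  have split: "(\<Sum>l \<in> {1..N} - {j}. f l) = f i + (\<Sum>l \<in> ?A. f l)" for f :: "nat \<Rightarrow> mpoly"
    by (rule sum.remove) (use assms in auto)
  have S: "(\<Sum>l \<in> ?A. ?D i (K j l p)) = (\<Sum>l \<in> ?A. K j l (?D i p))"
    by (intro sum.cong) (use assms in \<open>auto simp: K_dunkl_other\<close>)
  have s: "K i j (?D j p) = ?D i (K i j p)" "K i j (?D i p) = ?D j (K i j p)"
    using assms by (simp_all add: K_dunkl)
  show ?thesis unfolding dunkl_X_comm_def split using assms
    by (simp add: lin_add[OF lin_dunkl] lin_of_nat[OF lin_dunkl]
        lin_sum[OF lin_dunkl] lin_neg[OF lin_dunkl] S[unfolded One_nat_def] s K_commute[of j i] distrib_left)
qed

text \<open>For k outside {i, j} each commutator is zero or a multiple of one exchange, K_ik or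
  K_jk, which commutes with the Dunkl operator of the remaining index.\<close>

lemma dunkl_X_comm_symmetric:
  assumes "i \<in> {1..N}" "j \<in> {1..N}"
  shows "dunkl_X_comm N \<beta> i k (dunkl N \<beta> j p) + dunkl N \<beta> i (dunkl_X_comm N \<beta> j k p) =
    dunkl_X_comm N \<beta> j k (dunkl N \<beta> i p) + dunkl N \<beta> j (dunkl_X_comm N \<beta> i k p)"
proof -
  consider "i = j" | "k = j" "i \<noteq> j" | "k = i" "i \<noteq> j" | "k \<noteq> i" "k \<noteq> j" "i \<noteq> j" by blast
  then show ?thesis
  proof cases
    case 2
    then show ?thesis using dunkl_X_comm_symmetric_aux[OF assms] by simp
  next
    case 3
    then show ?thesis using dunkl_X_comm_symmetric_aux[OF assms(2,1)] by simp
  next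
    case 4
    then show ?thesis using assms
      by (simp add: dunkl_X_comm_def lin_of_nat[OF lin_dunkl] lin_neg[OF lin_dunkl] K_dunkl_other)
  qed simp
qed

text \<open>
  The two sides of the preceding identity are what remains of \<open>D\<^sub>i D\<^sub>j x\<^sub>k\<close> and \<open>D\<^sub>j D\<^sub>i x\<^sub>k\<close> after
  moving \<open>x\<^sub>k\<close> to the left, so \<open>[D\<^sub>i, D\<^sub>j]\<close> commutes with every \<open>x\<^sub>k\<close>; as it kills the constants,
  it vanishes.
\<close>

lemma dunkl_commute:
  assumes "i \<in> {1..N}" "j \<in> {1..N}"
  shows "dunkl N \<beta> i (dunkl N \<beta> j p) = dunkl N \<beta> j (dunkl N \<beta> i p)"
proof (induction p rule: mpoly_induct)
  case (X k p)
  have "dunkl N \<beta> a (dunkl N \<beta> b (X k * p)) = X k * dunkl N \<beta> a (dunkl N \<beta> b p) +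
      (dunkl_X_comm N \<beta> a k (dunkl N \<beta> b p) + dunkl N \<beta> a (dunkl_X_comm N \<beta> b k p))" for a b
    by (simp add: dunkl_X_mult lin_add[OF lin_dunkl])
  then show ?case using X dunkl_X_comm_symmetric[OF assms] by simp
qed (simp_all add: lin_add[OF lin_dunkl])

section \<open>The Dunkl Laplacian\<close>

lemma laplacian_eq: "laplacian N \<beta> p = (\<Sum>j \<in> {1..N}. dunkl N \<beta> j (dunkl N \<beta> j p))"
  by (simp add: laplacian_def numeral_2_eq_2)

lemma lin_laplacian: "lin (laplacian N \<beta>)"
  unfolding laplacian_eq[abs_def]
  by (rule lin_summation, rule lin_compose; rule lin_dunkl)

text \<open>The term i = j contributes 2 D_j and, for each other i, beta (K_ij D_j + D_j K_ij). The
  term of that i contributes -beta (K_ij D_i + D_i K_ij), which equivariance turns into the exact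
  negative.\<close>

lemma laplacian_X_mult:
  assumes j: "j \<in> {1..N}"
  shows "laplacian N \<beta> (X j * p) = X j * laplacian N \<beta> p + 2 * dunkl N \<beta> j p"
proof -
  let ?D = "dunkl N \<beta>" and ?C = "dunkl_X_comm N \<beta>" and ?b = "of_nat \<beta> :: mpoly"
  have "?D i (?D i (X j * p)) = X j * ?D i (?D i p) + (?C i j (?D i p) + ?D i (?C i j p))" for i
    by (simp add: dunkl_X_mult lin_add[OF lin_dunkl])
  then have "laplacian N \<beta> (X j * p) = X j * laplacian N \<beta> p +
      (\<Sum>i \<in> {1..N}. ?C i j (?D i p) + ?D i (?C i j p))"
    by (simp add: laplacian_eq sum.distrib sum_distrib_left)
  also have "(\<Sum>i \<in> {1..N}. ?C i j (?D i p) + ?D i (?C i j p)) = 2 * ?D j p"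
  proof -
    have "?C j j (?D j p) + ?D j (?C j j p) =
        2 * ?D j p + (\<Sum>i \<in> {1..N} - {j}. ?b * (K i j (?D j p) + ?D j (K i j p)))"
      by (simp add: dunkl_X_comm_def lin_add[OF lin_dunkl] lin_of_nat[OF lin_dunkl]
          lin_sum[OF lin_dunkl] K_commute[of j] distrib_left sum.distrib sum_distrib_left)
    moreover have "(\<Sum>i \<in> {1..N} - {j}. ?C i j (?D i p) + ?D i (?C i j p)) =
        (\<Sum>i \<in> {1..N} - {j}. - (?b * (K i j (?D j p) + ?D j (K i j p))))"
    proof (rule sum.cong)
      fix i assume "i \<in> {1..N} - {j}"
      then show "?C i j (?D i p) + ?D i (?C i j p) = - (?b * (K i j (?D j p) + ?D j (K i j p)))"
        using j by (simp add: dunkl_X_comm_def lin_of_nat[OF lin_dunkl] lin_neg[OF lin_dunkl]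
            K_dunkl distrib_left)
    qed simp
    ultimately show ?thesis
      unfolding sum.remove[OF finite_atLeastAtMost j] by (simp only: sum_negf add_0_right add.assoc right_minus)
  qed
  finally show ?thesis .
qed

lemma laplacian_dunkl:
  assumes "j \<in> {1..N}"
  shows "laplacian N \<beta> (dunkl N \<beta> j p) = dunkl N \<beta> j (laplacian N \<beta> p)"
  unfolding laplacian_eq lin_sum[OF lin_dunkl]
  by (intro sum.cong) (metis dunkl_commute[OF assms])+

lemma K_laplacian:
  assumes "i \<in> {1..N}" "j \<in> {1..N}"
  shows "K i j (laplacian N \<beta> p) = laplacian N \<beta> (K i j p)"
proof -
  have im: "transpose i j ` {1..N} = {1..N}"
    by (rule permutes_image[OF permutes_swap_id]) (use assms in auto)
  have "K i j (laplacian N \<beta> p) =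
      (\<Sum>k \<in> {1..N}. dunkl N \<beta> (transpose i j k) (dunkl N \<beta> (transpose i j k) (K i j p)))"
    by (simp only: laplacian_eq K_sum K_dunkl[OF assms])
  also have "\<dots> = (\<Sum>k \<in> transpose i j ` {1..N}. dunkl N \<beta> k (dunkl N \<beta> k (K i j p)))"
    by (simp add: sum.reindex inj_on_subset[OF inj_transpose])
  finally show ?thesis by (simp only: im laplacian_eq)
qed

section \<open>Cherednik operators in terms of Dunkl operators\<close>

text \<open>For k > j, writing x_k = x_j - (x_j - x_k) replaces the factor x_k by x_j at the cost of
  -(1 - K_jk). The N - j resulting copies of -p join the shift j - 1 to give N - 1.\<close>

lemma cherednik_eq:
  assumes j: "j \<in> {1..N}"
  shows "cherednik N \<beta> j p =
    X j * dunkl N \<beta> j p + of_nat \<beta> * (\<Sum>k \<in> {j<..N}. K j k p) - of_nat \<beta> * (of_nat N - 1) * p"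
proof -
  have step: "X k * divdiff j k p = X j * divdiff j k p - p + K j k p" if "k \<in> {j<..N}" for k
    using divdiff_eq[of j k p] that by (simp add: left_diff_distrib algebra_simps)
  have "{1..N} - {j} = {1..<j} \<union> {j<..N}" using j by auto
  also have "(\<Sum>k \<in> \<dots>. X j * divdiff j k p) =
      (\<Sum>k \<in> {1..<j}. X j * divdiff j k p) + (\<Sum>k \<in> {j<..N}. X j * divdiff j k p)"
    by (rule sum.union_disjoint) auto
  finally have split: "X j * (\<Sum>k \<in> {1..N} - {j}. divdiff j k p) =
      (\<Sum>k \<in> {1..<j}. X j * divdiff j k p) + (\<Sum>k \<in> {j<..N}. X j * divdiff j k p)"
    by (simp only: sum_distrib_left)
  have 1: "X j * dunkl N \<beta> j p = X j * pderiv_x j p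
      + of_nat \<beta> * ((\<Sum>k \<in> {1..<j}. X j * divdiff j k p) + (\<Sum>k \<in> {j<..N}. X j * divdiff j k p))"
    unfolding dunkl_def distrib_left[of "X j"] mult.left_commute[of "X j"] split ..
  have "(\<Sum>k \<in> {j<..N}. X k * divdiff j k p) = (\<Sum>k \<in> {j<..N}. X j * divdiff j k p - p + K j k p)"
    by (intro sum.cong step) simp_all
  also have "\<dots> = (\<Sum>k \<in> {j<..N}. X j * divdiff j k p) - (of_nat N - of_nat j) * p + (\<Sum>k \<in> {j<..N}. K j k p)"
    using j by (simp only: sum.distrib sum_subtractf sum_constant card_greaterThanAtMost) (simp add: of_nat_diff)
  finally have 2: "(\<Sum>k \<in> {j<..N}. X k * divdiff j k p) =
      (\<Sum>k \<in> {j<..N}. X j * divdiff j k p) - (of_nat N - of_nat j) * p + (\<Sum>k \<in> {j<..N}. K j k p)" .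
  have "a + b * s + b * (t - (n - i) * p + u) - b * (i - 1) * p = a + b * (s + t) + b * u - b * (n - 1) * p"
    for a b s t n i u :: mpoly
    by (simp add: algebra_simps)
  then show ?thesis unfolding cherednik_def 1 2 .
qed

lemma cherednik_omega_eq:
  assumes "\<omega> > 0" "j \<in> {1..N}"
  shows "cherednik_omega N \<beta> \<omega> j p =
    cherednik N \<beta> j p - Const (1 / (2 * of_real \<omega>)) * dunkl N \<beta> j (dunkl N \<beta> j p)"
proof -
  have "Const (1 / (2 * of_real \<omega>)) * (Const (2 * of_real \<omega>) * X j * q) = X j * q" for q
    using assms(1) by (simp flip: mult.assoc Const_mult)
  then show ?thesis
    using assms(2)
    by (simp add: cherednik_omega_def dunkl_dagger_def cherednik_eq right_diff_distrib)
qed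

lemma lin_cherednik: "j \<in> {1..N} \<Longrightarrow> lin (cherednik N \<beta> j)"
  by (subst ext[OF cherednik_eq], assumption)
    (rule lin_minus lin_plus lin_mult[OF lin_dunkl] lin_mult[OF lin_ident] lin_mult lin_summation lin_K)+

lemma laplacian_cherednik:
  assumes j: "j \<in> {1..N}"
  shows "laplacian N \<beta> (cherednik N \<beta> j p) =
    cherednik N \<beta> j (laplacian N \<beta> p) + 2 * dunkl N \<beta> j (dunkl N \<beta> j p)"
proof -
  have "laplacian N \<beta> (\<Sum>k \<in> {j<..N}. K j k p) = (\<Sum>k \<in> {j<..N}. K j k (laplacian N \<beta> p))"
    unfolding lin_sum[OF lin_laplacian]
    by (intro sum.cong) (use j in \<open>auto simp: K_laplacian\<close>)
  moreover have "laplacian N \<beta> (of_nat \<beta> * (of_nat N - 1) * p) = of_nat \<beta> * (of_nat N - 1) * laplacian N \<beta> p"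
    by (simp add: mult.assoc left_diff_distrib lin_diff[OF lin_laplacian] lin_of_nat[OF lin_laplacian])
  ultimately show ?thesis
    using j by (simp add: cherednik_eq lin_add[OF lin_laplacian] lin_diff[OF lin_laplacian]
        lin_of_nat[OF lin_laplacian] laplacian_X_mult laplacian_dunkl)
qed

section \<open>The exponential of the Laplacian\<close>

text \<open>The difference d - k is truncated: from k = d on the bound is \<open>low 0\<close>,
  which contains only 0, so the power vanishes.\<close>

lemma funpow_laplacian_low: "p \<in> low d \<Longrightarrow> (laplacian N \<beta> ^^ k) p \<in> low (d - k)"
proof (induction k)
  case (Suc k)
  then show ?case by (cases "d - k") (auto dest: laplacian_low simp: diff_Suc)
qed simp

lemma lin_funpow_laplacian: "lin (laplacian N \<beta> ^^ k)"
  by (rule lin_funpow[OF lin_laplacian])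

text \<open>The exponential on a single coefficient polynomial; \<open>exp_op_Delta\<close>
  identifies \<open>exp_op\<close> with its coefficientwise action.\<close>

definition exp_lap :: "nat \<Rightarrow> nat \<Rightarrow> complex \<Rightarrow> mpoly \<Rightarrow> mpoly" where
  "exp_lap N \<beta> c p = Sum_any (\<lambda>k. Const (c ^ k / fact k) * (laplacian N \<beta> ^^ k) p)"

text \<open>Any degree bound d may serve as cutoff, so series of several polynomials can be cut at a
  common place, supplied by \<open>low_common\<close>.\<close>

lemma exp_lap_eq:
  assumes "p \<in> low d"
  shows "exp_lap N \<beta> c p = (\<Sum>k<d. Const (c ^ k / fact k) * (laplacian N \<beta> ^^ k) p)"
  unfolding exp_lap_def
proof (rule Sum_any.expand_superset)
  have "(laplacian N \<beta> ^^ k) p = 0" if "d \<le> k" for k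
    using funpow_laplacian_low[OF assms, of k N \<beta>] that by simp
  then show "{k. Const (c ^ k / fact k) * (laplacian N \<beta> ^^ k) p \<noteq> 0} \<subseteq> {..<d}"
    using not_less by auto
qed simp

lemma low_common: "finite A \<Longrightarrow> \<exists>d. A \<subseteq> low d"
proof (induction A rule: finite_induct)
  case (insert p A)
  then obtain d e where "A \<subseteq> low d" "p \<in> low e" using low_exists by blast
  then have "insert p A \<subseteq> low (max d e)" by (auto intro: low_mono)
  then show ?case by blast
qed auto

lemma lin_exp_lap: "lin (exp_lap N \<beta> c)"
proof (rule linI)
  fix p q
  obtain d where "p \<in> low d" "q \<in> low d" using low_common[of "{p, q}"] by auto
  then show "exp_lap N \<beta> c (p + q) = exp_lap N \<beta> c p + exp_lap N \<beta> c q"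
    by (simp add: exp_lap_eq[of _ d] low_add lin_add[OF lin_funpow_laplacian] distrib_left sum.distrib)
next
  fix a p
  obtain d where "p \<in> low d" using low_exists by blast
  then show "exp_lap N \<beta> c (Const a * p) = Const a * exp_lap N \<beta> c p"
    by (simp add: exp_lap_eq[of _ d] low_Const_mult lin_scale[OF lin_funpow_laplacian] sum_distrib_left
        mult.left_commute)
qed

text \<open>Collecting the double series by total exponent k, the binomial theorem gives the
  coefficient (-c + c)^k / k!, which vanishes except at k = 0.\<close>

lemma exp_lap_inverse: "exp_lap N \<beta> (- c) (exp_lap N \<beta> c p) = p"
proof -
  let ?L = "laplacian N \<beta>"
  obtain d' where "p \<in> low d'" using low_exists by blast
  then obtain d where p: "p \<in> low (Suc d)" using low_mono le_SucI by blast
  define f where "f a b = Const ((- c) ^ a / fact a * (c ^ b / fact b)) * (?L ^^ (a + b)) p" for a b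
  have "exp_lap N \<beta> c p \<in> low (Suc d)"
    unfolding exp_lap_eq[OF p]
    by (intro low_sum low_Const_mult low_mono[OF funpow_laplacian_low[OF p]]) simp
  then have "exp_lap N \<beta> (- c) (exp_lap N \<beta> c p) = (\<Sum>a<Suc d. \<Sum>b<Suc d. f a b)"
    by (simp only: exp_lap_eq[of _ "Suc d"] p lin_sum[OF lin_funpow_laplacian]
        lin_scale[OF lin_funpow_laplacian] sum_distrib_left f_def Const_mult mult.assoc
        funpow_add comp_apply)
  also have "\<dots> = (\<Sum>(a, b) \<in> {..<Suc d} \<times> {..<Suc d}. f a b)"
    by (rule sum.cartesian_product)
  \<comment> \<open>Outside the triangle the Laplacian is applied more than d times to an element of
    \<open>low (Suc d)\<close>, which gives 0.\<close>
  also have "\<dots> = (\<Sum>(a, b) \<in> {(a, b). a + b < Suc d}. f a b)"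
  proof (rule sum.mono_neutral_right)
    have "f a b = 0 \<or> a + b < Suc d" for a b
      using funpow_laplacian_low[OF p, of "a + b" N \<beta>] by (cases "d < a + b") (auto simp: f_def)
    then show "\<forall>x \<in> {..<Suc d} \<times> {..<Suc d} - {(a, b). a + b < Suc d}. (case x of (a, b) \<Rightarrow> f a b) = 0"
      by auto
  qed auto
  also have "\<dots> = (\<Sum>k<Suc d. \<Sum>i\<le>k. f i (k - i))"
    by (rule sum.triangle_reindex)
  also have "\<dots> = (\<Sum>k<Suc d. Const (0 ^ k / fact k) * (?L ^^ k) p)"
  proof (rule sum.cong)
    fix k
    have "(- c) ^ i / fact i * (c ^ (k - i) / fact (k - i)) =
        of_nat (k choose i) * (- c) ^ i * c ^ (k - i) / fact k" if "i \<le> k" for i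
      using that by (simp add: binomial_fact field_simps)
    then have "(\<Sum>i\<le>k. (- c) ^ i / fact i * (c ^ (k - i) / fact (k - i))) = (- c + c) ^ k / fact k"
      unfolding binomial_ring sum_divide_distrib by (intro sum.cong) auto
    then show "(\<Sum>i\<le>k. f i (k - i)) = Const (0 ^ k / fact k) * (?L ^^ k) p"
      by (simp add: f_def sum_distrib_right[symmetric] Const_sum[symmetric])
  qed simp
  also have "\<dots> = p"
    by (simp add: sum.lessThan_Suc_shift del: sum.lessThan_Suc)
  finally show ?thesis .
qed

text \<open>
  If \<open>[L, A] = B\<close> commutes with \<open>L\<close>, then \<open>[L\<^sup>k, A] = k L\<^sup>k\<^sup>-\<^sup>1 B\<close>, so \<open>e\<^sup>c\<^sup>L A - A e\<^sup>c\<^sup>L = c e\<^sup>c\<^sup>L B\<close>.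
\<close>

lemma exp_lap_intertwine:
  assumes A: "lin A"
    and LA: "\<And>p. laplacian N \<beta> (A p) = A (laplacian N \<beta> p) + B p"
    and LB: "\<And>p. laplacian N \<beta> (B p) = B (laplacian N \<beta> p)"
  shows "A (exp_lap N \<beta> c p) = exp_lap N \<beta> c (A p - Const c * B p)"
proof -
  let ?L = "laplacian N \<beta>"
  have LkB: "(?L ^^ k) (B q) = B ((?L ^^ k) q)" for k q
    by (induction k) (simp_all add: LB)
  \<comment> \<open>Stated for \<open>Suc k\<close>, so that the exponent k - 1 of the commutator
    formula needs no truncated subtraction.\<close>
  have LkA: "(?L ^^ Suc k) (A p) = A ((?L ^^ Suc k) p) + of_nat (Suc k) * (?L ^^ k) (B p)" for k
  proof (induction k)
    case (Suc k)
    have "(?L ^^ Suc (Suc k)) (A p) = ?L ((?L ^^ Suc k) (A p))" by simp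
    also have "\<dots> = ?L (A ((?L ^^ Suc k) p)) + of_nat (Suc k) * ?L ((?L ^^ k) (B p))"
      by (simp only: Suc.IH lin_add[OF lin_laplacian] lin_of_nat[OF lin_laplacian])
    also have "\<dots> = A ((?L ^^ Suc (Suc k)) p) + of_nat (Suc (Suc k)) * (?L ^^ Suc k) (B p)"
      by (simp add: LA LkB LB algebra_simps)
    finally show ?case .
  qed (simp add: LA)
  obtain d where d: "p \<in> low d" "A p \<in> low d" "B p \<in> low d"
    using low_common[of "{p, A p, B p}"] by auto
  have coeff: "Const (c ^ Suc k / fact (Suc k)) * (of_nat (Suc k) * q) = Const c * (Const (c ^ k / fact k) * q)"
    for k q
  proof -
    have "c ^ Suc k / fact (Suc k) * of_nat (Suc k) = c * (c ^ k / fact k)"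
      by (simp add: field_simps del: of_nat_Suc)
    then show ?thesis by (simp only: of_nat_Const mult.assoc[symmetric] Const_mult[symmetric])
  qed
  \<comment> \<open>Cutting at \<open>Suc d\<close> lets the term of exponent 0 split off. The
    exponents \<open>Suc k\<close> with k < d then fit \<open>LkA\<close>, and \<open>coeff\<close>
    turns the commutator terms into the series of B p cut at d.\<close>
  have "exp_lap N \<beta> c (A p) = A p + (\<Sum>k<d. Const (c ^ Suc k / fact (Suc k)) * (?L ^^ Suc k) (A p))"
    using exp_lap_eq[OF low_mono[OF d(2), of "Suc d"]]
    by (simp add: sum.lessThan_Suc_shift del: sum.lessThan_Suc funpow.simps power_Suc fact_Suc)
  also have "\<dots> = (A p + (\<Sum>k<d. Const (c ^ Suc k / fact (Suc k)) * A ((?L ^^ Suc k) p)))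
      + Const c * (\<Sum>k<d. Const (c ^ k / fact k) * (?L ^^ k) (B p))"
    by (simp only: LkA distrib_left sum.distrib coeff sum_distrib_left add.assoc)
  also have "A p + (\<Sum>k<d. Const (c ^ Suc k / fact (Suc k)) * A ((?L ^^ Suc k) p)) = A (exp_lap N \<beta> c p)"
    using exp_lap_eq[OF low_mono[OF d(1), of "Suc d"]]
    by (simp add: sum.lessThan_Suc_shift lin_add[OF A] lin_sum[OF A] lin_scale[OF A]
        del: sum.lessThan_Suc funpow.simps power_Suc fact_Suc)
  finally show ?thesis
    by (simp add: lin_diff[OF lin_exp_lap] lin_scale[OF lin_exp_lap] exp_lap_eq[OF d(3)])
qed

text \<open>Here the commutator is B = 2 D_j^2, so c = 1/(4 omega) gives c B = D_j^2 / (2 omega),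
  exactly the difference in \<open>cherednik_omega_eq\<close>.\<close>

lemma cherednik_exp_lap:
  assumes "\<omega> > 0" "j \<in> {1..N}"
  shows "cherednik N \<beta> j (exp_lap N \<beta> (1 / (4 * of_real \<omega>)) p) =
    exp_lap N \<beta> (1 / (4 * of_real \<omega>)) (cherednik_omega N \<beta> \<omega> j p)"
proof -
  let ?c = "1 / (4 * of_real \<omega>) :: complex"
  have "Const ?c * (2 * q) = Const (?c * 2) * q" for q
    using of_nat_Const[of 2] by (simp only: Const_mult of_nat_numeral mult.assoc)
  moreover have "?c * 2 = 1 / (2 * of_real \<omega>)" by simp
  ultimately have *: "Const ?c * (2 * q) = Const (1 / (2 * of_real \<omega>)) * q" for q
    by (simp only:)
  have "cherednik N \<beta> j (exp_lap N \<beta> ?c p) =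
      exp_lap N \<beta> ?c (cherednik N \<beta> j p - Const ?c * (2 * dunkl N \<beta> j (dunkl N \<beta> j p)))"
  proof (rule exp_lap_intertwine[OF lin_cherednik laplacian_cherednik])
    show "laplacian N \<beta> (2 * dunkl N \<beta> j (dunkl N \<beta> j p)) =
        2 * dunkl N \<beta> j (dunkl N \<beta> j (laplacian N \<beta> p))" for p
      using assms(2) lin_of_nat[OF lin_laplacian, of N \<beta> 2] by (simp add: laplacian_dunkl)
  qed (use assms in auto)
  then show ?thesis
    by (simp only: * cherednik_omega_eq[OF assms])
qed

text \<open>The intertwining lemma with vanishing commutator.\<close>

lemma K_exp_lap:
  assumes "i \<in> {1..N}" "j \<in> {1..N}"
  shows "K i j (exp_lap N \<beta> c p) = exp_lap N \<beta> c (K i j p)"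
  using exp_lap_intertwine[OF lin_K, of N \<beta> i j "\<lambda>_. 0" c p] K_laplacian[OF assms, of \<beta>] by simp

section \<open>Coefficientwise operators on superpolynomials\<close>

lemma coeffwise_coeffwise:
  "T 0 = 0 \<Longrightarrow> S 0 = 0 \<Longrightarrow> coeffwise T (coeffwise S F) = coeffwise (\<lambda>p. T (S p)) F"
  by (rule poly_mapping_eqI) (simp add: lookup_coeffwise)

lemma coeffwise_sum:
  assumes "lin T"
  shows "coeffwise T (\<Sum>a \<in> A. F a) = (\<Sum>a \<in> A. coeffwise T (F a))"
  by (rule poly_mapping_eqI)
    (simp add: lookup_sum lookup_coeffwise lin_zero[OF assms] lin_sum[OF assms])

text \<open>The signs in \<open>theta\<close>, \<open>dtheta\<close> and \<open>kappa\<close> are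
  polynomials equal to 1 or -1, so they pass through linear operators; hence coefficientwise linear
  operators commute with all three.\<close>

lemma lin_sign: "lin T \<Longrightarrow> T ((-1) ^ n * p) = (-1) ^ n * T p"
  by (simp add: minus_one_power_iff lin_neg)

lemma coeffwise_theta: "lin T \<Longrightarrow> coeffwise T (theta i F) = theta i (coeffwise T F)"
  by (rule poly_mapping_eqI)
    (simp add: lookup_coeffwise lookup_theta theta_sign_def lin_zero lin_sign)

lemma coeffwise_dtheta: "lin T \<Longrightarrow> coeffwise T (dtheta i F) = dtheta i (coeffwise T F)"
  by (rule poly_mapping_eqI)
    (simp add: lookup_coeffwise lookup_dtheta theta_sign_def lin_zero lin_sign)

lemma coeffwise_kappa: "lin T \<Longrightarrow> coeffwise T (kappa i j F) = kappa i j (coeffwise T F)"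
  by (rule poly_mapping_eqI)
    (simp add: lookup_coeffwise lookup_kappa reorder_sign_def lin_zero lin_sign)

lemma coeffwise_calK_word:
  assumes T: "lin T"
    and K: "\<And>i p. i \<in> set is \<Longrightarrow> K i (Suc i) (T p) = T (K i (Suc i) p)"
  shows "calK_word is (coeffwise T F) = coeffwise T (calK_word is F)"
  using K
proof (induction "is")
  case (Cons i "is")
  have "calK i (Suc i) (coeffwise T G) = coeffwise T (calK i (Suc i) G)" for G
    using Cons.prems by (simp add: calK_def coeffwise_kappa[OF T] coeffwise_coeffwise lin_zero[OF T])
  then show ?case using Cons by (simp add: calK_word_def)
qed (simp add: calK_word_def)

text \<open>A decomposition of w reduces the claim to single letters. These lie in
  \<open>{1..<N}\<close>, so i and \<open>Suc i\<close> are both in the range of the hypothesis on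
  \<open>K\<close>.\<close>

lemma coeffwise_calK_perm:
  assumes T: "lin T"
    and K: "\<And>i j p. i \<in> {1..N} \<Longrightarrow> j \<in> {1..N} \<Longrightarrow> K i j (T p) = T (K i j p)"
    and w: "w permutes {1..N}"
  shows "calK_perm N w (coeffwise T F) = coeffwise T (calK_perm N w F)"
proof -
  obtain "is" where "is": "set is \<subseteq> {1..<N}" "word_perm is = w"
    using word_perm_exists[OF w] by blast
  show ?thesis unfolding calK_perm_eq[OF "is"]
    by (rule coeffwise_calK_word[OF T], rule K) (use "is"(1) in auto)
qed

lemma lookup_scale: "Poly_Mapping.lookup (scale a F) I = Const a * Poly_Mapping.lookup F I"
  by (simp add: scale_def lookup_coeffwise)

lemma exp_op_Delta:
  "exp_op (\<lambda>G. scale c (Delta N \<beta> G)) F = coeffwise (exp_lap N \<beta> c) F"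
proof -
  let ?T = "\<lambda>G. scale c (Delta N \<beta> G)"
  have pow: "Poly_Mapping.lookup ((?T ^^ k) F) I = Const (c ^ k) * (laplacian N \<beta> ^^ k) (Poly_Mapping.lookup F I)"
    for k I
    by (induction k)
      (simp_all add: lookup_scale Delta_def lookup_coeffwise lin_scale[OF lin_laplacian] Const_mult mult.assoc)
  have summand: "Poly_Mapping.lookup (scale (1 / fact k) ((?T ^^ k) F)) I =
      Const (c ^ k / fact k) * (laplacian N \<beta> ^^ k) (Poly_Mapping.lookup F I)" for k I
    by (simp add: lookup_scale pow mult.assoc[symmetric] Const_mult[symmetric])
  \<comment> \<open>One cutoff has to serve all coefficients at once: only finitely many are
    nonzero, and 0 satisfies every bound.\<close>
  obtain d where "insert 0 (Poly_Mapping.lookup F ` Poly_Mapping.keys F) \<subseteq> low d"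
    using low_common[of "insert 0 (Poly_Mapping.lookup F ` Poly_Mapping.keys F)"] by auto
  then have d: "Poly_Mapping.lookup F I \<in> low d" for I
    by (cases "I \<in> Poly_Mapping.keys F") (auto simp: in_keys_iff)
  have "exp_op ?T F = (\<Sum>k<d. scale (1 / fact k) ((?T ^^ k) F))"
    unfolding exp_op_def
  proof (rule Sum_any.expand_superset)
    have "scale (1 / fact k) ((?T ^^ k) F) = 0" if "d \<le> k" for k
      by (rule poly_mapping_eqI) (use funpow_laplacian_low[OF d, of k N \<beta>] that in \<open>simp add: summand\<close>)
    then show "{k. scale (1 / fact k) ((?T ^^ k) F) \<noteq> 0} \<subseteq> {..<d}"
      using not_less by blast
  qed simp
  also have "\<dots> = coeffwise (exp_lap N \<beta> c) F"
    by (rule poly_mapping_eqI)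
      (simp add: lookup_sum summand lookup_coeffwise lin_zero[OF lin_exp_lap] exp_lap_eq[OF d])
  finally show ?thesis .
qed

theorem lemma4:
  fixes N \<beta> n :: nat and \<omega> :: real
  assumes "N \<ge> 1" and "\<beta> > 0" and "\<omega> > 0" and "n \<in> {1..N}"
  shows "(\<forall>F \<in> superpolys N. H_rat N \<beta> \<omega> n F =
            (exp_op (\<lambda>G. scale (- 1 / (4 * of_real \<omega>)) (Delta N \<beta> G)) \<circ> H_trig N \<beta> n \<circ>
             exp_op (\<lambda>G. scale (1 / (4 * of_real \<omega>)) (Delta N \<beta> G))) F) \<and>
         (\<forall>F \<in> superpolys N. I_rat N \<beta> \<omega> (n - 1) F =
            (exp_op (\<lambda>G. scale (- 1 / (4 * of_real \<omega>)) (Delta N \<beta> G)) \<circ> I_trig N \<beta> (n - 1) \<circ>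
             exp_op (\<lambda>G. scale (1 / (4 * of_real \<omega>)) (Delta N \<beta> G))) F)"
proof -
  define c :: complex where "c = 1 / (4 * of_real \<omega>)"
  have c': "- 1 / (4 * of_real \<omega>) = - c" by (simp add: c_def)
  define E where "E = coeffwise (exp_lap N \<beta> c)"
  \<comment> \<open>Everything below takes the form A E = E A', which passes to powers and sums;
    cancelling E on the left at the end then needs only this one-sided inverse.\<close>
  have inverse: "coeffwise (exp_lap N \<beta> (- c)) (E F) = F" for F
    by (rule poly_mapping_eqI)
      (simp add: E_def lookup_coeffwise lin_zero[OF lin_exp_lap] exp_lap_inverse)
  have E_sum: "(\<Sum>a \<in> A. E (G a)) = E (\<Sum>a \<in> A. G a)" for A :: "'a set" and G
    by (simp add: E_def coeffwise_sum[OF lin_exp_lap])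
  have zero: "cherednik N \<beta> j 0 = 0" "cherednik_omega N \<beta> \<omega> j 0 = 0" "exp_lap N \<beta> c 0 = 0"
    if "j \<in> {1..N}" for j
    using that assms(3)
    by (simp_all add: cherednik_omega_eq lin_zero[OF lin_cherednik] lin_zero[OF lin_exp_lap])
  have pow: "(coeffwise (cherednik N \<beta> j) ^^ m) (E F) = E ((coeffwise (cherednik_omega N \<beta> \<omega> j) ^^ m) F)"
    if j: "j \<in> {1..N}" for j m F
  proof (induction m)
    case (Suc m)
    have "coeffwise (cherednik N \<beta> j) (E G) = E (coeffwise (cherednik_omega N \<beta> \<omega> j) G)" for G
      unfolding E_def
      by (simp add: coeffwise_coeffwise zero[OF j] cherednik_exp_lap[OF assms(3) j, folded c_def])
    then show ?case using Suc by simp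
  qed simp
  have H: "H_trig N \<beta> n (E F) = E (H_rat N \<beta> \<omega> n F)" for F
    by (simp only: H_trig_def H_rat_def E_sum[symmetric]) (simp add: pow)
  have perm: "calK_perm N w (E F) = E (calK_perm N w F)" if "w permutes {1..N}" for w F
    unfolding E_def by (rule coeffwise_calK_perm[OF lin_exp_lap K_exp_lap that])
  have 1: "1 \<in> {1..N}" using assms(1) by simp
  have "theta 1 (dtheta 1 (E F)) = E (theta 1 (dtheta 1 F))" for F
    by (simp only: E_def coeffwise_theta[OF lin_exp_lap] coeffwise_dtheta[OF lin_exp_lap])
  then have I: "I_trig N \<beta> (n - 1) (E F) = E (I_rat N \<beta> \<omega> (n - 1) F)" for F
    unfolding I_trig_def I_rat_def E_sum[symmetric]
    by (intro sum.cong) (simp_all only: pow[OF 1] perm mem_Collect_eq)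
  show ?thesis
    unfolding exp_op_Delta c' c_def[symmetric] E_def[symmetric] comp_apply H I inverse
    by simp
qed

end
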